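(* Let $\mathbb{K}$ be a field, $V=\mathbb{K}^\ell$, and let $\mathcal{A}$ be an essential central arrangement of hyperplanes in $V$. Let $H_1,H_2\in\mathcal{A}$, put $\mathcal{A}_i:=\mathcal{A}\setminus\{H_i\}$ for $i=1,2$, and $\mathcal{B}:=\mathcal{A}\setminus\{H_1,H_2\}$. If $\mathcal{A}$ and $\mathcal{B}$ are both free, then at least one of $\mathcal{A}_1$ and $\mathcal{A}_2$ is free.
   Context: An arrangement of hyperplanes is a finite set $\mathcal{A}$ of linear hyperplanes in $V=\mathbb{K}^\ell$; it is essential if $\bigcap_{H\in\mathcal{A}}H=\{0\}$. Let $S=\mathbb{K}[x_1,\dots,x_\ell]$ be the coordinate ring of $V$, $\mathrm{Der}\,S=\bigoplus_{i=1}^\ell S\,\partial_{x_i}$, and for each $H$ fix a linear form $\alpha_H$ with $H=\ker\alpha_H$. The logarithmic derivation module is $D(\mathcal{A})=\{\theta\in\mathrm{Der}\,S \mid \theta(\alpha_H)\in S\alpha_H \text{ for all } H\in\mathcal{A}\}$, a graded $S$-module. $\mathcal{A}$ is free if $D(\mathcal{A})$ is a free $S$-module, i.e. $D(\mathcal{A})\cong\bigoplus_{i=1}^\ell S[-d_i]$ for some integers $d_i$ (the exponents). *)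

theory Defs
  imports "HOL-Analysis.Analysis" "HOL-Library.Poly_Mapping"
begin

text \<open>
  The vector space \<open>V\<close> is \<open>'k ^ 'n\<close>, with \<open>\<ell> = CARD('n)\<close>, and \<open>S = \<bbbK>[x\<^sub>i | i :: 'n]\<close> is the
  monoid algebra over \<open>'k\<close> of the monoid of exponent vectors. Since a member of \<open>'n\<close> always exists,
  the case \<open>\<ell> = 0\<close> is left out; there are no hyperplanes in that case.
\<close>

type_synonym ('n, 'k) mpoly = "('n \<Rightarrow>\<^sub>0 nat) \<Rightarrow>\<^sub>0 'k"

definition partial :: "'n \<Rightarrow> ('n, 'k::comm_ring_1) mpoly \<Rightarrow> ('n, 'k) mpoly" where
  "partial i p = (\<Sum>m\<in>Poly_Mapping.keys p.
     Poly_Mapping.single (m - Poly_Mapping.single i 1)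
       (of_nat (Poly_Mapping.lookup m i) * Poly_Mapping.lookup p m))"

text \<open>
  An element \<open>\<Sum>\<^sub>i \<theta>\<^sub>i \<partial>\<^sub>i\<close> of \<open>Der S\<close> is represented by its vector of coefficients \<open>\<theta>\<close>; the
  \<open>S\<close>-module structure on \<open>Der S\<close> is then componentwise, with scalar multiplication \<open>(*s)\<close>.
\<close>

type_synonym ('n, 'k) derivation = "(('n, 'k) mpoly) ^ 'n"

definition der_apply ::
    "('n::finite, 'k::comm_ring_1) derivation \<Rightarrow> ('n, 'k) mpoly \<Rightarrow> ('n, 'k) mpoly" where
  "der_apply \<theta> f = (\<Sum>i\<in>UNIV. \<theta> $ i * partial i f)"

definition linear_form :: "'k::comm_ring_1 ^ 'n::finite \<Rightarrow> ('n, 'k) mpoly" where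
  "linear_form a = (\<Sum>i\<in>UNIV. Poly_Mapping.single (Poly_Mapping.single i 1) (a $ i))"

definition form_kernel :: "'k::comm_ring_1 ^ 'n::finite \<Rightarrow> ('k ^ 'n) set" where
  "form_kernel a = {v. (\<Sum>i\<in>UNIV. a $ i * v $ i) = 0}"

definition linear_hyperplane :: "('k::field ^ 'n::finite) set \<Rightarrow> bool" where
  "linear_hyperplane H \<longleftrightarrow> vec.subspace H \<and> vec.dim H + 1 = CARD('n)"

definition arrangement :: "('k::field ^ 'n::finite) set set \<Rightarrow> bool" where
  "arrangement A \<longleftrightarrow> finite A \<and> (\<forall>H\<in>A. linear_hyperplane H)"

definition essential :: "('k::field ^ 'n::finite) set set \<Rightarrow> bool" where
  "essential A \<longleftrightarrow> \<Inter>A = {0}"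

definition defining_form :: "('k::field ^ 'n::finite) set \<Rightarrow> ('n, 'k) mpoly" where
  "defining_form H = linear_form (SOME a. form_kernel a = H)"

definition log_der :: "('k::field ^ 'n::finite) set set \<Rightarrow> ('n, 'k) derivation set" where
  "log_der A = {\<theta>. \<forall>H\<in>A. defining_form H dvd der_apply \<theta> (defining_form H)}"

definition free_submodule :: "('a::comm_ring_1 ^ 'n::finite) set \<Rightarrow> bool" where
  "free_submodule M \<longleftrightarrow> (\<exists>B. \<not> module.dependent (*s) B \<and> module.span (*s) B = M)"

definition free_arrangement :: "('k::field ^ 'n::finite) set set \<Rightarrow> bool" where
  "free_arrangement A \<longleftrightarrow> free_submodule (log_der A)"


lemma module_vec: "module ((*s) :: 'a::comm_ring_1 \<Rightarrow> 'a ^ 'n::finite \<Rightarrow> 'a ^ 'n)"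
  by unfold_locales (vector algebra_simps)+

lemma log_der_submodule: "module.subspace (*s) (log_der A)"
proof -
  have add: "der_apply (x + y) f = der_apply x f + der_apply y f"
    for x y :: "('n::finite, 'k::field) derivation" and f
    by (simp add: der_apply_def algebra_simps sum.distrib)
  have scale: "der_apply (c *s x) f = c * der_apply x f"
    for c and x :: "('n::finite, 'k::field) derivation" and f
    by (simp add: der_apply_def algebra_simps sum_distrib_left)
  have zero: "der_apply 0 f = 0" for f :: "('n::finite, 'k::field) mpoly"
    by (simp add: der_apply_def)
  show ?thesis
    unfolding module.subspace_def[OF module_vec] log_der_def
    by (auto simp: add scale zero)
qed

lemma partial_superset:
  assumes "finite T" "Poly_Mapping.keys p \<subseteq> T"
  shows "partial i p = (\<Sum>m\<in>T. Poly_Mapping.single (m - Poly_Mapping.single i 1)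
       (of_nat (Poly_Mapping.lookup m i) * Poly_Mapping.lookup p m))"
  unfolding partial_def using assms
  by (intro sum.mono_neutral_left) (auto simp: in_keys_iff)

lemma partial_add: "partial i (p + q) = partial i p + partial i q"
proof -
  let ?T = "Poly_Mapping.keys p \<union> Poly_Mapping.keys q"
  have "Poly_Mapping.keys (p + q) \<subseteq> ?T" by (rule Poly_Mapping.keys_add)
  then show ?thesis
    by (simp add: partial_superset[of ?T] lookup_add algebra_simps single_add sum.distrib)
qed

lemma partial_zero [simp]: "partial i 0 = 0"
  by (simp add: partial_def)

lemma partial_single:
  "partial i (Poly_Mapping.single m c) =
     Poly_Mapping.single (m - Poly_Mapping.single i 1) (of_nat (Poly_Mapping.lookup m i) * c)"
  by (simp add: partial_superset[of "{m}"])

lemma partial_sum: "partial i (\<Sum>x\<in>X. f x) = (\<Sum>x\<in>X. partial i (f x))"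
  by (induction X rule: infinite_finite_induct) (auto simp: partial_add)

lemma partial_linear_form: "partial i (linear_form a) = Poly_Mapping.single 0 (a $ i)"
proof -
  have "partial i (linear_form a) =
      (\<Sum>j\<in>UNIV. if j = i then Poly_Mapping.single 0 (a $ i) else 0)"
    unfolding linear_form_def partial_sum partial_single
    by (intro sum.cong) (auto simp: lookup_single when_def)
  then show ?thesis by simp
qed

lemma poly_mapping_eq_sum_single:
  "p = (\<Sum>m\<in>Poly_Mapping.keys p. Poly_Mapping.single m (Poly_Mapping.lookup p m))"
  by (intro poly_mapping_eqI)
     (auto simp: lookup_sum lookup_single when_def in_keys_iff sum.delta')

lemma partial_mult: "partial i (p * q) = partial i p * q + p * partial i q"
proof -
  have single: "partial i (Poly_Mapping.single m c * Poly_Mapping.single n d) =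
      partial i (Poly_Mapping.single m c) * Poly_Mapping.single n d +
      Poly_Mapping.single m c * partial i (Poly_Mapping.single n d)"
    for m n :: "'a \<Rightarrow>\<^sub>0 nat" and c d :: 'b
  proof -
    have l: "m - Poly_Mapping.single i 1 + n = m + n - Poly_Mapping.single i 1"
      if "Poly_Mapping.lookup m i \<noteq> 0"
      using that by (intro poly_mapping_eqI) (auto simp: lookup_add lookup_minus lookup_single when_def)
    have r: "m + (n - Poly_Mapping.single i 1) = m + n - Poly_Mapping.single i 1"
      if "Poly_Mapping.lookup n i \<noteq> 0"
      using that by (intro poly_mapping_eqI) (auto simp: lookup_add lookup_minus lookup_single when_def)
    show ?thesis
      using l r
      by (cases "Poly_Mapping.lookup m i = 0"; cases "Poly_Mapping.lookup n i = 0")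
         (simp_all add: partial_single mult_single lookup_add algebra_simps flip: single_add)
  qed
  have q: "partial i (Poly_Mapping.single m c * q) =
      partial i (Poly_Mapping.single m c) * q + Poly_Mapping.single m c * partial i q" for m c
    by (subst (1 2 3) poly_mapping_eq_sum_single[of q])
       (simp add: sum_distrib_left partial_sum single sum.distrib)
  show ?thesis
    by (subst (1 2 3) poly_mapping_eq_sum_single[of p])
       (simp add: sum_distrib_right partial_sum q sum.distrib)
qed

lemma linear_hyperplane_form_kernel:
  fixes H :: "('k::field ^ 'n::finite) set"
  assumes "linear_hyperplane H"
  shows "\<exists>a. a \<noteq> 0 \<and> form_kernel a = H"
proof -
  interpret vp: vector_space_pair "(*s) :: 'k \<Rightarrow> 'k ^ 'n \<Rightarrow> 'k ^ 'n" "(*) :: 'k \<Rightarrow> 'k \<Rightarrow> 'k" ..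
  have sub: "vec.subspace H" and dim: "vec.dim H + 1 = CARD('n)"
    using assms by (auto simp: linear_hyperplane_def)
  obtain B where B: "B \<subseteq> H" "vec.independent B" "H \<subseteq> vec.span B" "card B = vec.dim H"
    using vec.basis_exists by blast
  have spB: "vec.span B = H"
    using B sub by (simp add: vec.span_minimal subset_antisym)
  define C where "C = vec.extend_basis B"
  have C: "B \<subseteq> C" "vec.independent C" "vec.span C = UNIV"
    using B(2) by (auto simp: C_def vec.extend_basis_superset vec.independent_extend_basis)
  have fin: "finite C" using C(2) by (rule vec.finiteI_independent)
  have "card C = CARD('n)"
    using vec.dim_eq_card[of C UNIV] C vec.dim_UNIV by (simp add: card_cart_basis)
  then have "card (C - B) = 1"
    using fin C(1) B(4) dim by (subst card_Diff_subset) (auto intro: finite_subset)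
  then obtain c where c: "C - B = {c}" by (auto simp: card_1_singleton_iff)
  define f where "f = vp.construct C (\<lambda>b. if b = c then 1 else 0)"
  interpret f: Vector_Spaces.linear "(*s)" "(*)" f
    unfolding f_def by (rule vp.linear_construct[OF C(2)])
  have fC: "f b = (if b = c then 1 else 0)" if "b \<in> C" for b
    unfolding f_def using C(2) that by (rule vp.construct_basis)
  have fB: "f b = 0" if "b \<in> vec.span B" for b
  proof (rule f.eq_0_on_span[OF _ that])
    fix x assume "x \<in> B" then have "x \<in> C" "x \<noteq> c" using C(1) c by auto
    then show "f x = 0" using fC by simp
  qed
  define a where "a = (\<chi> i. f (axis i 1))"
  have fa: "f v = (\<Sum>i\<in>UNIV. a $ i * v $ i)" for v
  proof -
    have "f v = f (\<Sum>i\<in>UNIV. v $ i *s axis i 1)" by (simp add: basis_expansion)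
    also have "\<dots> = (\<Sum>i\<in>UNIV. a $ i * v $ i)"
      by (simp add: f.sum f.scale a_def mult.commute)
    finally show ?thesis .
  qed
  have "c \<in> C" using c by auto
  then have "f c = 1" using fC by simp
  then have "a \<noteq> 0" using fa[of c] by auto
  moreover have "v \<in> H \<longleftrightarrow> f v = 0" for v
  proof
    assume "f v = 0"
    have "v \<in> vec.span (insert c B)" using C(1,3) c by (metis UNIV_I insert_Diff_single insert_is_Un Diff_partition Un_commute)
    then obtain k where k: "v - k *s c \<in> vec.span B" by (auto simp: vec.span_insert)
    have "0 = f (v - k *s c)" using fB[OF k] by simp
    also have "\<dots> = - k" using \<open>f v = 0\<close> \<open>f c = 1\<close> by (simp add: f.diff f.scale)
    finally show "v \<in> H" using k spB by simp
  qed (use fB spB in auto)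
  ultimately show ?thesis by (auto simp: form_kernel_def fa intro!: exI[of _ a])
qed

lemma form_kernel_eq_imp_proportional:
  fixes a b :: "'k::field ^ 'n::finite"
  assumes "form_kernel a = form_kernel b" "a \<noteq> 0"
  shows "\<exists>t. t \<noteq> 0 \<and> a = t *s b"
proof -
  have ker: "p *s axis j 1 - q *s axis i 1 \<in> form_kernel x \<longleftrightarrow> x $ j * p = x $ i * q"
    for x :: "'k ^ 'n" and p q i j
  proof -
    have s: "(\<Sum>k\<in>UNIV. x $ k * (r * axis l 1 $ k)) = x $ l * r" for r l
    proof -
      have "(\<Sum>k\<in>UNIV. x $ k * (r * axis l 1 $ k)) = (\<Sum>k\<in>UNIV. if k = l then x $ l * r else 0)"
        by (rule sum.cong) (auto simp: axis_def)
      then show ?thesis by simp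
    qed
    show ?thesis
      by (simp add: form_kernel_def right_diff_distrib sum_subtractf s)
  qed
  have "b \<noteq> 0"
  proof
    assume "b = 0"
    then have U: "form_kernel a = UNIV" using assms(1) by (simp add: form_kernel_def)
    have "a $ i = 0" for i
    proof -
      have "1 *s axis i 1 - 0 *s axis i 1 \<in> form_kernel a" unfolding U ..
      then show ?thesis unfolding ker by simp
    qed
    then show False using assms(2) by (simp add: vec_eq_iff)
  qed
  then obtain i where i: "b $ i \<noteq> 0" by (auto simp: vec_eq_iff)
  have proportional: "a $ j * b $ i = a $ i * b $ j" for j
  proof -
    have "b $ i *s axis j 1 - b $ j *s axis i 1 \<in> form_kernel b"
      unfolding ker by (rule mult.commute)
    then show ?thesis unfolding assms(1)[symmetric] ker .
  qed
  have "a $ j = a $ i / b $ i * b $ j" for j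
    using nonzero_eq_divide_eq[OF i, of "a $ j" "a $ i * b $ j"] proportional[of j] by simp
  then have "a = (a $ i / b $ i) *s b"
    unfolding vec_eq_iff vector_smult_component by blast
  moreover from this have "a $ i / b $ i \<noteq> 0" using assms(2) by (metis vector_smult_lzero)
  ultimately show ?thesis by blast
qed

text \<open>The choice of defining forms is immaterial.\<close>

lemma log_der_iff:
  fixes A :: "('k::field ^ 'n::finite) set set"
  assumes "arrangement A"
  shows "\<theta> \<in> log_der A \<longleftrightarrow>
    (\<forall>H\<in>A. \<forall>a. form_kernel a = H \<longrightarrow> linear_form a dvd der_apply \<theta> (linear_form a))"
proof -
  have chosen: "form_kernel (SOME a. form_kernel a = H) = H" if "H \<in> A" for H
    using someI_ex[of "\<lambda>a. form_kernel a = H"] linear_hyperplane_form_kernel[of H] assms that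
    by (auto simp: arrangement_def)
  have transfer: "linear_form a dvd der_apply \<theta> (linear_form a)"
    if dvd: "linear_form b dvd der_apply \<theta> (linear_form b)"
      and ker: "form_kernel a = H" "form_kernel b = H" and "H \<in> A" for a b H
  proof -
    obtain e where e: "e \<noteq> 0" "form_kernel e = H"
      using linear_hyperplane_form_kernel assms \<open>H \<in> A\<close> by (auto simp: arrangement_def)
    obtain u where u: "u \<noteq> 0" "e = u *s a"
      using form_kernel_eq_imp_proportional[of e a] e ker by auto
    have "a \<noteq> 0" using u e by auto
    then obtain t where t: "t \<noteq> 0" "a = t *s b"
      using form_kernel_eq_imp_proportional[of a b] ker by auto
    let ?t = "Poly_Mapping.single 0 t :: ('n, 'k) mpoly"
    have lf: "linear_form a = ?t * linear_form b"
      unfolding linear_form_def sum_distrib_left mult_single by (simp add: t(2))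
    have der: "der_apply \<theta> (linear_form a) = ?t * der_apply \<theta> (linear_form b)"
    proof -
      have "Poly_Mapping.single 0 (a $ i) = ?t * Poly_Mapping.single 0 (b $ i)" for i
        by (simp add: t(2) mult_single)
      then show ?thesis
        by (simp only: der_apply_def partial_linear_form sum_distrib_left mult.left_commute)
    qed
    show ?thesis unfolding der unfolding lf using dvd by (rule mult_dvd_mono[OF dvd_refl])
  qed
  show ?thesis
  proof
    assume L: "\<theta> \<in> log_der A"
    show "\<forall>H\<in>A. \<forall>a. form_kernel a = H \<longrightarrow> linear_form a dvd der_apply \<theta> (linear_form a)"
    proof (intro ballI allI impI)
      fix H a assume H: "H \<in> A" "form_kernel a = H"
      show "linear_form a dvd der_apply \<theta> (linear_form a)"
        by (rule transfer[OF _ H(2) chosen[OF H(1)] H(1)])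
           (use L H(1) in \<open>simp add: log_der_def defining_form_def\<close>)
    qed
  next
    assume R: "\<forall>H\<in>A. \<forall>a. form_kernel a = H \<longrightarrow> linear_form a dvd der_apply \<theta> (linear_form a)"
    show "\<theta> \<in> log_der A"
      unfolding log_der_def defining_form_def mem_Collect_eq
    proof
      fix H assume "H \<in> A"
      then show "linear_form (SOME a. form_kernel a = H) dvd
          der_apply \<theta> (linear_form (SOME a. form_kernel a = H))"
        using R[rule_format, OF \<open>H \<in> A\<close> chosen] by simp
    qed
  qed
qed

end

theory Submission
  imports Defs
begin

text \<open>
  Write \<open>\<alpha>\<close>, \<open>\<beta>\<close> for the forms of \<open>H1\<close>, \<open>H2\<close> and \<open>N \<subseteq> M\<close> for the logarithmic derivations of \<open>A\<close> and
  \<open>A - {H1, H2}\<close>. If all values \<open>m(\<alpha>)\<close>, \<open>m \<in> M\<close>, are multiples modulo \<open>\<alpha>\<close> of the value of one member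
  of a basis of \<open>M\<close>, then \<open>log_der (A - {H2}) = {m \<in> M. \<alpha> dvd m(\<alpha>)}\<close> is free, and similarly for \<open>\<beta>\<close>.

  Choose a homogeneous basis of \<open>M\<close> with as many members in \<open>N\<close> as possible, and let \<open>P\<close> index the
  members outside \<open>N\<close>. By maximality, the coordinates at \<open>P\<close> of every element of \<open>N\<close> have no constant
  term, so the determinant of \<open>N\<close> in \<open>M\<close> vanishes at the origin to order at least \<open>card P\<close>. That
  determinant divides a power of \<open>\<alpha>\<beta>\<close> and is divisible by neither \<open>\<alpha>\<^sup>2\<close> nor \<open>\<beta>\<^sup>2\<close>, whence \<open>card P \<le> 2\<close>.
  If \<open>card P \<le> 1\<close>, both values are principal. If \<open>P = {p, q}\<close>, the linear parts of the two rows at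
  \<open>P\<close> contain a nonzero minor; it equals \<open>\<alpha>\<beta>\<close> up to a constant. Modulo \<open>\<alpha>\<close> this \<open>2 \<times> 2\<close> matrix of linear
  forms has proportional rows or proportional columns; the former makes the \<open>\<alpha>\<close>-values principal, the
  latter the \<open>\<beta>\<close>-values.
\<close>

section \<open>Polynomials as a graded domain\<close>

text \<open>Taking \<open>h\<close> as a joint function of monomial and coefficient lets homogeneous
  components, substitutions and changes of variables all be instances.\<close>

definition linear_extension ::
    "('a \<Rightarrow> 'b::zero \<Rightarrow> 'c::comm_monoid_add) \<Rightarrow> ('a \<Rightarrow>\<^sub>0 'b) \<Rightarrow> 'c" where
  "linear_extension h p = (\<Sum>m\<in>Poly_Mapping.keys p. h m (Poly_Mapping.lookup p m))"

lemma linear_extension_superset: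
  assumes "finite T" "Poly_Mapping.keys p \<subseteq> T" "\<And>m. h m 0 = 0"
  shows "linear_extension h p = (\<Sum>m\<in>T. h m (Poly_Mapping.lookup p m))"
  unfolding linear_extension_def using assms
  by (intro sum.mono_neutral_left) (auto simp: in_keys_iff)

lemma linear_extension_0 [simp]: "linear_extension h 0 = 0"
  by (simp add: linear_extension_def)

lemma linear_extension_single:
  assumes "\<And>m. h m 0 = 0"
  shows "linear_extension h (Poly_Mapping.single m c) = h m c"
  by (simp add: linear_extension_superset[of "{m}"] assms)

lemma linear_extension_add:
  assumes "\<And>m. h m 0 = 0" "\<And>m c d. h m (c + d) = h m c + h m d"
  shows "linear_extension h (p + q) = linear_extension h p + linear_extension h q"
proof -
  let ?T = "Poly_Mapping.keys p \<union> Poly_Mapping.keys q"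
  have "Poly_Mapping.keys (p + q) \<subseteq> ?T" by (rule Poly_Mapping.keys_add)
  then show ?thesis
    by (simp add: linear_extension_superset[of ?T] assms lookup_add sum.distrib)
qed

lemma poly_mapping_add_induct [case_names zero single add]:
  fixes p :: "'a \<Rightarrow>\<^sub>0 'b::comm_monoid_add"
  assumes "P 0" and "\<And>m c. P (Poly_Mapping.single m c)"
    and "\<And>p q. P p \<Longrightarrow> P q \<Longrightarrow> P (p + q)"
  shows "P p"
proof -
  have "P (\<Sum>m\<in>T. Poly_Mapping.single m (Poly_Mapping.lookup p m))" if "finite T" for T
    using that by induction (auto intro: assms)
  then show ?thesis
    using poly_mapping_eq_sum_single[of p] by (metis finite_keys)
qed

lemma linear_extension_mult:
  fixes h :: "'a::comm_monoid_add \<Rightarrow> 'b::comm_ring_1 \<Rightarrow> 'c::comm_ring_1"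
  assumes h: "\<And>m. h m 0 = 0" "\<And>m c d. h m (c + d) = h m c + h m d"
    and mult: "\<And>m n c d. h (m + n) (c * d) = h m c * h n d"
  shows "linear_extension h (p * q) = linear_extension h p * linear_extension h q"
proof (induction p rule: poly_mapping_add_induct)
  case (single m c)
  show ?case
    by (induction q rule: poly_mapping_add_induct)
       (simp_all add: mult_single linear_extension_single h mult linear_extension_add distrib_left)
qed (simp_all add: linear_extension_add h distrib_right)

text \<open>An injective numbering of the variables embeds the ring into polynomials in variables
  indexed by \<open>nat\<close>. Exponent vectors are linearly ordered there, so products of nonzero
  elements are nonzero.\<close>

lemma mpoly_mult_eq_0:
  fixes p q :: "('n::finite, 'k::idom) mpoly"
  assumes "p * q = 0"
  shows "p = 0 \<or> q = 0"
proof -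
  obtain \<iota> :: "'n \<Rightarrow> nat" where \<iota>: "inj \<iota>"
    using finite_imp_inj_to_nat_seg[of "UNIV :: 'n set"] by auto
  define \<rho> :: "('n \<Rightarrow>\<^sub>0 nat) \<Rightarrow> nat \<Rightarrow>\<^sub>0 nat"
    where "\<rho> m = (\<Sum>i\<in>UNIV. Poly_Mapping.single (\<iota> i) (Poly_Mapping.lookup m i))" for m
  have \<rho>_add: "\<rho> (m + n) = \<rho> m + \<rho> n" for m n
    by (simp add: \<rho>_def lookup_add single_add sum.distrib)
  have "Poly_Mapping.lookup (\<rho> m) (\<iota> i) = Poly_Mapping.lookup m i" for m i
    using \<iota> by (simp add: \<rho>_def lookup_sum lookup_single when_def inj_eq)
  then have \<rho>_inj: "m = n" if "\<rho> m = \<rho> n" for m n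
    using that by (metis poly_mapping_eqI)
  let ?h = "\<lambda>m c. Poly_Mapping.single (\<rho> m) (c :: 'k)"
  have h: "?h m 0 = 0" "?h m (c + d) = ?h m c + ?h m d" "?h (m + n) (c * d) = ?h m c * ?h n d"
    for m n c d by (simp_all add: single_add \<rho>_add mult_single)
  have lookup: "Poly_Mapping.lookup (linear_extension ?h r) (\<rho> m) = Poly_Mapping.lookup r m" for r m
  proof (induction r rule: poly_mapping_add_induct)
    case (single n c)
    show ?case using \<rho>_inj[of n m] by (auto simp: linear_extension_single lookup_single when_def)
  qed (simp_all add: linear_extension_add h lookup_add)
  have inj: "r = 0" if "linear_extension ?h r = 0" for r
    using that lookup[of r] by (intro poly_mapping_eqI) simp
  have "linear_extension ?h p * linear_extension ?h q = 0"
    using linear_extension_mult[of ?h p q] h assms by simp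
  then show ?thesis
    using inj mult_eq_0_iff by blast
qed

lemma mpoly_mult_left_cancel:
  fixes p q r :: "('n::finite, 'k::idom) mpoly"
  assumes "p * q = p * r" "p \<noteq> 0"
  shows "q = r"
  using mpoly_mult_eq_0[of p "q - r"] assms by (simp add: algebra_simps)

lemma mpoly_prod_ne_0:
  fixes p :: "'i \<Rightarrow> ('n::finite, 'k::idom) mpoly"
  assumes "\<And>i. i \<in> I \<Longrightarrow> p i \<noteq> 0"
  shows "(\<Prod>i\<in>I. p i) \<noteq> 0"
  using assms by (induction I rule: infinite_finite_induct) (auto dest: mpoly_mult_eq_0)

lemma mpoly_power_ne_0:
  fixes p :: "('n::finite, 'k::idom) mpoly"
  shows "p \<noteq> 0 \<Longrightarrow> p ^ n \<noteq> 0"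
  by (induction n) (auto dest: mpoly_mult_eq_0)

section \<open>The grading by total degree\<close>

definition mon_degree :: "('n::finite \<Rightarrow>\<^sub>0 nat) \<Rightarrow> nat" where
  "mon_degree m = (\<Sum>i\<in>UNIV. Poly_Mapping.lookup m i)"

lemma mon_degree_add: "mon_degree (m + n) = mon_degree m + mon_degree n"
  by (simp add: mon_degree_def lookup_add sum.distrib)

lemma mon_degree_eq_0: "mon_degree m = 0 \<longleftrightarrow> m = 0"
  by (auto simp: mon_degree_def intro: poly_mapping_eqI)

lemma mon_degree_single: "mon_degree (Poly_Mapping.single i k) = k"
  by (simp add: mon_degree_def lookup_single when_def)

lemma mon_degree_eq_1:
  assumes "mon_degree m = 1"
  obtains i where "m = Poly_Mapping.single i 1"
proof -
  obtain i where i: "Poly_Mapping.lookup m i = 1" "\<And>j. j \<noteq> i \<Longrightarrow> Poly_Mapping.lookup m j = 0"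
    using assms unfolding mon_degree_def by (subst (asm) sum_eq_1_iff) auto
  then have "m = Poly_Mapping.single i 1"
    by (intro poly_mapping_eqI) (auto simp: lookup_single when_def)
  then show thesis by (rule that)
qed

definition hcomp :: "nat \<Rightarrow> ('n::finite, 'k::comm_ring_1) mpoly \<Rightarrow> ('n, 'k) mpoly" where
  "hcomp d = linear_extension (\<lambda>m c. if mon_degree m = d then Poly_Mapping.single m c else 0)"

lemma hcomp_0 [simp]: "hcomp d 0 = 0"
  by (simp add: hcomp_def)

lemma hcomp_single:
  "hcomp d (Poly_Mapping.single m c) = (if mon_degree m = d then Poly_Mapping.single m c else 0)"
  by (simp add: hcomp_def linear_extension_single)

lemma hcomp_add: "hcomp d (p + q) = hcomp d p + hcomp d q"
  unfolding hcomp_def by (rule linear_extension_add) (simp_all add: single_add)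

lemma hcomp_uminus: "hcomp d (- p) = - hcomp d p"
  using hcomp_add[of d p "- p"] by (simp add: eq_neg_iff_add_eq_0 add.commute)

lemma hcomp_diff: "hcomp d (p - q) = hcomp d p - hcomp d q"
  using hcomp_add[of d p "- q"] by (simp add: hcomp_uminus)

lemma hcomp_sum: "hcomp d (\<Sum>i\<in>I. p i) = (\<Sum>i\<in>I. hcomp d (p i))"
  by (induction I rule: infinite_finite_induct) (auto simp: hcomp_add)

lemma hcomp_hcomp: "hcomp d (hcomp e p) = (if d = e then hcomp e p else 0)"
  by (induction p rule: poly_mapping_add_induct) (auto simp: hcomp_single hcomp_add)

lemma hcomp_const: "hcomp 0 p = Poly_Mapping.single 0 (Poly_Mapping.lookup p 0)"
  by (induction p rule: poly_mapping_add_induct)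
     (auto simp: hcomp_single hcomp_add mon_degree_eq_0 lookup_add single_add lookup_single when_def)

lemma hcomp_mult: "hcomp d (p * q) = (\<Sum>i\<le>d. hcomp i p * hcomp (d - i) q)"
proof (induction p rule: poly_mapping_add_induct)
  case (single m c)
  show ?case
  proof (induction q rule: poly_mapping_add_induct)
    case (single n e)
    have "(\<Sum>i\<le>d. hcomp i (Poly_Mapping.single m c) * hcomp (d - i) (Poly_Mapping.single n e)) =
        (\<Sum>i\<le>d. if i = mon_degree m then (if mon_degree n = d - mon_degree m
            then Poly_Mapping.single (m + n) (c * e) else 0) else 0)"
      by (intro sum.cong) (auto simp: hcomp_single mult_single)
    then show ?case
      by (auto simp: mult_single hcomp_single mon_degree_add)
  qed (simp_all add: distrib_left hcomp_add sum.distrib)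
qed (simp_all add: distrib_right hcomp_add sum.distrib)

text \<open>Allowing every larger bound makes it possible to use one common bound for a sum, or for
  all entries of a vector.\<close>

lemma hcomp_decomposition:
  "\<exists>D. \<forall>D'\<ge>D. p = (\<Sum>d\<le>D'. hcomp d p)"
proof (induction p rule: poly_mapping_add_induct)
  case (single m c)
  show ?case by (rule exI[of _ "mon_degree m"]) (auto simp: hcomp_single)
next
  case (add p q)
  then obtain D E where "\<forall>D'\<ge>D. p = (\<Sum>d\<le>D'. hcomp d p)" "\<forall>D'\<ge>E. q = (\<Sum>d\<le>D'. hcomp d q)"
    by blast
  then show ?case
    by (intro exI[of _ "max D E"]) (auto simp: hcomp_add sum.distrib)
qed auto

text \<open>In this form the zero polynomial is homogeneous of every degree.\<close>

definition homogeneous :: "nat \<Rightarrow> ('n::finite, 'k::comm_ring_1) mpoly \<Rightarrow> bool" where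
  "homogeneous d p \<longleftrightarrow> hcomp d p = p"

lemma homogeneous_hcomp: "homogeneous d (hcomp d p)"
  by (simp add: homogeneous_def hcomp_hcomp)

lemma hcomp_homogeneous: "homogeneous e p \<Longrightarrow> hcomp d p = (if d = e then p else 0)"
  using hcomp_hcomp[of d e p] by (simp add: homogeneous_def)

lemma hcomp_mult_homogeneous:
  assumes "homogeneous e f"
  shows "hcomp d (c * f) = (if e \<le> d then hcomp (d - e) c * f else 0)"
proof -
  have "hcomp d (f * c) = (\<Sum>i\<le>d. if i = e then f * hcomp (d - e) c else 0)"
    unfolding hcomp_mult by (intro sum.cong) (auto simp: hcomp_homogeneous[OF assms])
  then show ?thesis by (auto simp: mult.commute)
qed

lemma homogeneous_mult:
  "homogeneous d p \<Longrightarrow> homogeneous e q \<Longrightarrow> homogeneous (d + e) (p * q)"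
  using hcomp_mult_homogeneous[of e q "d + e" p] by (simp add: homogeneous_def)

text \<open>In total degree \<open>a + b\<close> every pair of components other than
  \<open>(a, b)\<close> has a factor below its bound. The bounds need not be attained: the component
  in degree \<open>a\<close> or \<open>b\<close> may vanish.\<close>

lemma hcomp_mult_lowest:
  assumes "\<And>i. i < a \<Longrightarrow> hcomp i p = 0" "\<And>i. i < b \<Longrightarrow> hcomp i q = 0"
  shows "d < a + b \<Longrightarrow> hcomp d (p * q) = 0" "hcomp (a + b) (p * q) = hcomp a p * hcomp b q"
proof -
  show "hcomp d (p * q) = 0" if "d < a + b"
    unfolding hcomp_mult
  proof (rule sum.neutral, rule ballI)
    fix i assume "i \<in> {..d}"
    then have "i < a \<or> d - i < b" using that by auto
    then show "hcomp i p * hcomp (d - i) q = 0" using assms by auto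
  qed
  have "hcomp (a + b) (p * q) = (\<Sum>i\<le>a + b. if i = a then hcomp a p * hcomp b q else 0)"
    unfolding hcomp_mult
  proof (rule sum.cong)
    fix i assume "i \<in> {..a + b}"
    then have "i < a \<or> i = a \<or> a + b - i < b" by auto
    then show "hcomp i p * hcomp (a + b - i) q = (if i = a then hcomp a p * hcomp b q else 0)"
      using assms by auto
  qed simp
  then show "hcomp (a + b) (p * q) = hcomp a p * hcomp b q" by simp
qed

lemma hcomp_prod_lowest:
  fixes p :: "'i \<Rightarrow> ('n::finite, 'k::comm_ring_1) mpoly"
  assumes "finite I" "\<And>i j. i \<in> I \<Longrightarrow> j < w i \<Longrightarrow> hcomp j (p i) = 0"
  shows "(\<forall>d<sum w I. hcomp d (prod p I) = 0) \<and> hcomp (sum w I) (prod p I) = (\<Prod>i\<in>I. hcomp (w i) (p i))"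
  using assms
proof (induction I rule: finite_induct)
  case empty
  show ?case using hcomp_const[of 1] by simp
next
  case (insert x I)
  then show ?case
    using hcomp_mult_lowest[of "w x" "p x" "sum w I" "prod p I"] by auto
qed

text \<open>Each term of the Leibniz expansion takes one entry from every row, so lower bounds
  \<open>w i\<close> for the orders of the rows add up.\<close>

lemma hcomp_det_lowest:
  fixes T :: "('n::finite, 'k::comm_ring_1) mpoly ^ 'm::finite ^ 'm"
  assumes "\<And>i j d. d < w i \<Longrightarrow> hcomp d (T $ i $ j) = 0"
  shows "d < sum w UNIV \<Longrightarrow> hcomp d (det T) = 0"
    and "hcomp (sum w UNIV) (det T) = det (\<chi> i j. hcomp (w i) (T $ i $ j))"
proof -
  have sgn: "hcomp d (of_int (sign \<pi>) * x) = of_int (sign \<pi>) * hcomp d x" for d \<pi> and x :: "('n, 'k) mpoly"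
    by (cases \<pi> rule: sign_cases) (simp_all add: hcomp_uminus)
  have l: "(\<forall>d<sum w UNIV. hcomp d (\<Prod>i\<in>UNIV. T $ i $ \<pi> i) = 0) \<and>
      hcomp (sum w UNIV) (\<Prod>i\<in>UNIV. T $ i $ \<pi> i) = (\<Prod>i\<in>UNIV. hcomp (w i) (T $ i $ \<pi> i))" for \<pi>
    using hcomp_prod_lowest[of UNIV w "\<lambda>i. T $ i $ \<pi> i"] assms by simp
  show "hcomp d (det T) = 0" if "d < sum w UNIV"
    unfolding det_def hcomp_sum sgn using l that by simp
  show "hcomp (sum w UNIV) (det T) = det (\<chi> i j. hcomp (w i) (T $ i $ j))"
    unfolding det_def hcomp_sum sgn using l by simp
qed

lemma homogeneous_linear_form: "homogeneous 1 (linear_form a)"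
  by (simp add: homogeneous_def linear_form_def hcomp_sum hcomp_single mon_degree_single)

lemma lookup_linear_form: "Poly_Mapping.lookup (linear_form a) (Poly_Mapping.single i 1) = a $ i"
proof -
  have "Poly_Mapping.lookup (linear_form a) (Poly_Mapping.single i 1) =
      (\<Sum>j\<in>UNIV. if j = i then a $ i else 0)"
    unfolding linear_form_def lookup_sum
    by (intro sum.cong) (auto simp: lookup_single when_def dest!: arg_cong[of _ _ "\<lambda>m. Poly_Mapping.lookup m i"])
  then show ?thesis by simp
qed

lemma linear_form_eq_iff: "linear_form a = linear_form b \<longleftrightarrow> a = b"
  by (metis lookup_linear_form vec_eq_iff)

lemma linear_form_0 [simp]: "linear_form 0 = 0"
  by (simp add: linear_form_def)

lemma linear_form_scale: "linear_form (t *s a) = Poly_Mapping.single 0 t * linear_form a"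
  by (simp add: linear_form_def sum_distrib_left mult_single)

lemma homogeneous_1_linear_form:
  assumes "homogeneous 1 p"
  obtains a where "p = linear_form a"
proof -
  \<comment> \<open>Both sides are additive in \<open>p\<close>, so this can be proved for arbitrary
    \<open>p\<close> by induction on monomials; homogeneity of \<open>p\<close> would not be
    inherited by the summands.\<close>
  have "hcomp 1 p = linear_form (\<chi> i. Poly_Mapping.lookup p (Poly_Mapping.single i 1))"
  proof (induction p rule: poly_mapping_add_induct)
    case (single m c)
    show ?case
    proof (cases "mon_degree m = 1")
      case True
      then obtain i where i: "m = Poly_Mapping.single i 1" by (rule mon_degree_eq_1)
      have [simp]: "Poly_Mapping.single i (Suc 0) = Poly_Mapping.single j (Suc 0) \<longleftrightarrow> j = i" for j
        by (auto dest!: arg_cong[of _ _ "\<lambda>m. Poly_Mapping.lookup m j"] simp: lookup_single when_def split: if_splits)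
      have "linear_form (\<chi> j. Poly_Mapping.lookup (Poly_Mapping.single m c) (Poly_Mapping.single j 1)) =
          (\<Sum>j\<in>UNIV. if j = i then Poly_Mapping.single m c else 0)"
        unfolding linear_form_def by (intro sum.cong) (auto simp: i lookup_single when_def)
      then show ?thesis using True by (simp add: hcomp_single)
    next
      case False
      then have "Poly_Mapping.lookup (Poly_Mapping.single m c) (Poly_Mapping.single j 1) = 0" for j
        using mon_degree_single[of j 1] by (auto simp: lookup_single when_def)
      then show ?thesis using False by (simp add: hcomp_single linear_form_def)
    qed
  qed (auto simp: linear_form_def hcomp_add lookup_add single_add sum.distrib)
  then show thesis using assms that unfolding homogeneous_def by metis
qed

section \<open>Linear forms as prime elements\<close>

lemma single_eq_prod_variables:
  fixes m :: "'n::finite \<Rightarrow>\<^sub>0 nat" and c :: "'k::comm_ring_1"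
  shows "Poly_Mapping.single m c = Poly_Mapping.single 0 c *
    (\<Prod>i\<in>UNIV. Poly_Mapping.single (Poly_Mapping.single i 1) 1 ^ Poly_Mapping.lookup m i)"
proof -
  have power: "Poly_Mapping.single (Poly_Mapping.single i 1) (1 :: 'k) ^ k =
      Poly_Mapping.single (Poly_Mapping.single i k) 1" for i :: 'n and k
    by (induction k) (simp_all add: mult_single flip: single_add)
  have prod: "(\<Prod>i\<in>I. Poly_Mapping.single (e i) (1 :: 'k)) = Poly_Mapping.single (\<Sum>i\<in>I. e i) 1"
    for e :: "'n \<Rightarrow> 'n \<Rightarrow>\<^sub>0 nat" and I
    by (induction I rule: infinite_finite_induct) (simp_all add: mult_single)
  have "m = (\<Sum>i\<in>UNIV. Poly_Mapping.single i (Poly_Mapping.lookup m i))"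
    by (rule poly_mapping_eqI) (simp add: lookup_sum lookup_single when_def)
  then show ?thesis
    unfolding power prod by (simp add: mult_single)
qed

section \<open>Substitution homomorphisms and congruences modulo a linear form\<close>

definition subst :: "('n::finite \<Rightarrow> ('n, 'k::comm_ring_1) mpoly) \<Rightarrow> ('n, 'k) mpoly \<Rightarrow> ('n, 'k) mpoly" where
  "subst g = linear_extension
     (\<lambda>m c. Poly_Mapping.single 0 c * (\<Prod>i\<in>UNIV. g i ^ Poly_Mapping.lookup m i))"

lemma subst_single:
  "subst g (Poly_Mapping.single m c) =
     Poly_Mapping.single 0 c * (\<Prod>i\<in>UNIV. g i ^ Poly_Mapping.lookup m i)"
  unfolding subst_def by (simp add: linear_extension_single)

lemma subst_const: "subst g (Poly_Mapping.single 0 c) = Poly_Mapping.single 0 c"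
  by (simp add: subst_single)

lemma subst_0 [simp]: "subst g 0 = 0"
  by (simp add: subst_def)

lemma subst_add: "subst g (p + q) = subst g p + subst g q"
  unfolding subst_def by (rule linear_extension_add) (simp_all add: single_add distrib_right)

lemma subst_mult: "subst g (p * q) = subst g p * subst g q"
  unfolding subst_def
proof (rule linear_extension_mult)
  fix m n :: "'a \<Rightarrow>\<^sub>0 nat" and c d :: 'b
  have "Poly_Mapping.single 0 (c * d) = Poly_Mapping.single 0 c * Poly_Mapping.single (0 :: 'a \<Rightarrow>\<^sub>0 nat) d"
    by (simp add: mult_single)
  then show "Poly_Mapping.single 0 (c * d) * (\<Prod>i\<in>UNIV. g i ^ Poly_Mapping.lookup (m + n) i) =
      Poly_Mapping.single 0 c * (\<Prod>i\<in>UNIV. g i ^ Poly_Mapping.lookup m i) *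
      (Poly_Mapping.single 0 d * (\<Prod>i\<in>UNIV. g i ^ Poly_Mapping.lookup n i))"
    by (simp only: lookup_add power_add prod.distrib ac_simps)
qed (simp_all add: single_add distrib_right)

lemma subst_sum: "subst g (\<Sum>i\<in>I. p i) = (\<Sum>i\<in>I. subst g (p i))"
  by (induction I rule: infinite_finite_induct) (auto simp: subst_add)

lemma subst_diff: "subst g (p - q) = subst g p - subst g q"
  using subst_add[of g "p - q" q] by simp

lemma subst_linear_form: "subst g (linear_form a) = (\<Sum>i\<in>UNIV. Poly_Mapping.single 0 (a $ i) * g i)"
proof -
  have "(\<Prod>j\<in>UNIV. g j ^ Poly_Mapping.lookup (Poly_Mapping.single i 1) j) = g i" for i
  proof -
    have "(\<Prod>j\<in>UNIV. g j ^ Poly_Mapping.lookup (Poly_Mapping.single i 1) j) =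
        (\<Prod>j\<in>UNIV. if j = i then g i else 1)"
      by (intro prod.cong) (auto simp: lookup_single when_def)
    then show ?thesis by simp
  qed
  then show ?thesis by (simp add: linear_form_def subst_sum subst_single)
qed

lemma dvd_mult_diff:
  fixes a :: "'a::comm_ring_1"
  assumes "a dvd x - y" "a dvd u - v"
  shows "a dvd x * u - y * v"
proof -
  have "x * u - y * v = (x - y) * u + y * (u - v)" by (simp add: algebra_simps)
  then show ?thesis using assms by simp
qed

lemma dvd_power_diff:
  fixes a :: "'a::comm_ring_1"
  assumes "a dvd x - y"
  shows "a dvd x ^ n - y ^ n"
proof (induction n)
  case (Suc n)
  show ?case using dvd_mult_diff[OF assms Suc.IH] by simp
qed simp

lemma dvd_prod_diff:
  fixes a :: "'a::comm_ring_1"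
  assumes "\<And>i. i \<in> I \<Longrightarrow> a dvd x i - y i"
  shows "a dvd prod x I - prod y I"
  using assms
proof (induction I rule: infinite_finite_induct)
  case (insert i I)
  then show ?case using dvd_mult_diff[of a "x i" "y i" "prod x I" "prod y I"] by simp
qed simp_all

text \<open>Congruence modulo \<open>a\<close> is compatible with sums, products and powers, so it
  passes from the variables to every polynomial expression in them.\<close>

lemma dvd_diff_subst:
  assumes "\<And>i. a dvd Poly_Mapping.single (Poly_Mapping.single i 1) 1 - g i"
  shows "a dvd p - subst g p"
proof (induction p rule: poly_mapping_add_induct)
  case (single m c)
  show ?case
    unfolding subst_single
    by (subst single_eq_prod_variables)
       (intro dvd_mult_diff dvd_prod_diff dvd_power_diff assms, simp)
next
  case (add p q)
  then show ?case using dvd_add[OF add] by (simp add: subst_add algebra_simps)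
qed simp

text \<open>Solving \<open>linear_form a = 0\<close> for one variable embeds the quotient ring back into the
  polynomial ring.\<close>

lemma linear_form_quotient:
  fixes a :: "'k::field ^ 'n::finite"
  assumes "a \<noteq> 0"
  shows "\<exists>g. (\<forall>p. subst g p = 0 \<longleftrightarrow> linear_form a dvd p) \<and>
    (\<forall>p. homogeneous 1 p \<longrightarrow> homogeneous 1 (subst g p))"
proof -
  obtain i where i: "a $ i \<noteq> 0" using assms by (auto simp: vec_eq_iff)
  let ?X = "\<lambda>j. Poly_Mapping.single (Poly_Mapping.single j 1) 1 :: ('n, 'k) mpoly"
  define g where "g j = ?X j - (if j = i then Poly_Mapping.single 0 (1 / a $ i) * linear_form a else 0)" for j
  \<comment> \<open>Only variable \<open>i\<close> is altered, and its coefficient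
    \<open>a $ i\<close> cancels the factor \<open>1 / a $ i\<close>; the form thus becomes itself
    minus itself.\<close>
  have "subst g (linear_form a) = (\<Sum>j\<in>UNIV. Poly_Mapping.single 0 (a $ j) * ?X j) -
      (\<Sum>j\<in>UNIV. if j = i then linear_form a else 0)"
    unfolding subst_linear_form sum_subtractf[symmetric]
    using i by (intro sum.cong) (auto simp: g_def right_diff_distrib mult_single simp flip: mult.assoc)
  then have zero: "subst g (linear_form a) = 0"
    by (simp add: linear_form_def mult_single)
  have dvd: "linear_form a dvd p - subst g p" for p
    by (rule dvd_diff_subst) (auto simp: g_def)
  show ?thesis
  proof (intro exI[of _ g] conjI allI impI)
    show "subst g p = 0 \<longleftrightarrow> linear_form a dvd p" for p
    proof
      assume "linear_form a dvd p"
      then show "subst g p = 0" by (auto simp: subst_mult zero)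
    qed (use dvd[of p] in simp)
    show "homogeneous 1 (subst g p)" if p: "homogeneous 1 p" for p
    proof -
      obtain b where b: "p = linear_form b" using homogeneous_1_linear_form[OF p] .
      have hg: "homogeneous 1 (g j)" for j
        using homogeneous_linear_form[of a]
        by (auto simp: g_def homogeneous_def hcomp_diff hcomp_single mon_degree_single
            hcomp_mult_homogeneous[OF homogeneous_linear_form] mon_degree_eq_0)
      have "homogeneous 1 (Poly_Mapping.single 0 c * g j)" for c j
        using hg by (simp add: homogeneous_def hcomp_mult_homogeneous[OF hg] hcomp_single mon_degree_eq_0)
      then show ?thesis unfolding b subst_linear_form by (simp add: homogeneous_def hcomp_sum)
    qed
  qed
qed

text \<open>The multiples of the form are the kernel of a ring homomorphism into a domain.\<close>

lemma linear_form_prime: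
  fixes a :: "'k::field ^ 'n::finite"
  assumes "a \<noteq> 0" "linear_form a dvd p * q"
  shows "linear_form a dvd p \<or> linear_form a dvd q"
proof -
  obtain g where g: "\<And>p. subst g p = 0 \<longleftrightarrow> linear_form a dvd p"
    using linear_form_quotient[OF assms(1)] by blast
  have "subst g p * subst g q = 0" using assms(2) g[of "p * q"] by (simp add: subst_mult)
  then show ?thesis using mpoly_mult_eq_0 g by blast
qed

lemma linear_form_prime_power:
  fixes a :: "'k::field ^ 'n::finite"
  assumes "a \<noteq> 0" "linear_form a dvd p ^ n"
  shows "linear_form a dvd p"
  using assms(2)
proof (induction n)
  case 0
  \<comment> \<open>Exponent \<open>0\<close> is the assertion that a linear form is not a unit: its
    multiples have no constant term.\<close>
  then obtain r where "1 = r * linear_form a" by (auto simp: mult.commute)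
  then have "hcomp 0 (1 :: ('n, 'k) mpoly) = 0"
    by (metis hcomp_mult_homogeneous[OF homogeneous_linear_form] not_one_le_zero)
  then show ?case by (simp add: hcomp_const lookup_one)
next
  case (Suc n)
  then show ?case using linear_form_prime[OF assms(1), of p "p ^ n"] by auto
qed

text \<open>In degree 1, only the constant term of the cofactor contributes.\<close>

lemma homogeneous_1_multiple:
  fixes x y :: "('n::finite, 'k::field) mpoly"
  assumes "homogeneous 1 x" "homogeneous 1 y" "x dvd y"
  obtains k where "y = Poly_Mapping.single 0 k * x"
proof -
  obtain c where c: "y = c * x" using assms(3) by (metis dvd_def mult.commute)
  have "y = hcomp 1 (c * x)" using assms(2) c by (simp add: homogeneous_def)
  also have "\<dots> = hcomp 0 c * x" by (subst hcomp_mult_homogeneous[OF assms(1)]) simp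
  finally show thesis using that by (simp add: hcomp_const)
qed

text \<open>Used in contrapositive form: forms of distinct hyperplanes do not divide each
  other.\<close>

lemma linear_form_dvd_linear_form:
  fixes a b :: "'k::field ^ 'n::finite"
  assumes "linear_form a dvd linear_form b" "b \<noteq> 0"
  shows "form_kernel a = form_kernel b"
proof -
  obtain k where "linear_form b = Poly_Mapping.single 0 k * linear_form a"
    using homogeneous_1_multiple[OF homogeneous_linear_form homogeneous_linear_form assms(1)] .
  then have b: "b = k *s a" by (simp add: linear_form_eq_iff flip: linear_form_scale)
  then have "k \<noteq> 0" using assms(2) by auto
  moreover have "(\<Sum>i\<in>UNIV. b $ i * v $ i) = k * (\<Sum>i\<in>UNIV. a $ i * v $ i)" for v
    by (simp add: b sum_distrib_left mult.assoc)
  ultimately show ?thesis by (simp add: form_kernel_def)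
qed

text \<open>Modulo the form, the matrix with rows \<open>(x1, x2)\<close> and
  \<open>(y1, y2)\<close> is singular and its entries are still linear forms. If \<open>x1\<close>
  is nonzero there, it is prime and divides \<open>x2\<close> or \<open>y1\<close>; the quotient is
  a constant for degree reasons, and it is the factor of proportionality of the columns or of the
  rows.\<close>

lemma linear_2x2_minor_dvd:
  fixes a :: "'k::field ^ 'n::finite" and x1 x2 y1 y2 :: "('n, 'k) mpoly"
  assumes a: "a \<noteq> 0"
    and hom: "homogeneous 1 x1" "homogeneous 1 x2" "homogeneous 1 y1" "homogeneous 1 y2"
    and dvd: "linear_form a dvd x1 * y2 - x2 * y1"
  obtains (rows) s t where "s \<noteq> 0 \<or> t \<noteq> 0"
      "linear_form a dvd Poly_Mapping.single 0 s * x1 + Poly_Mapping.single 0 t * y1"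
      "linear_form a dvd Poly_Mapping.single 0 s * x2 + Poly_Mapping.single 0 t * y2"
    | (columns) s t where "s \<noteq> 0 \<or> t \<noteq> 0"
      "linear_form a dvd Poly_Mapping.single 0 s * x1 + Poly_Mapping.single 0 t * x2"
      "linear_form a dvd Poly_Mapping.single 0 s * y1 + Poly_Mapping.single 0 t * y2"
proof -
  obtain g where g: "\<And>p. subst g p = 0 \<longleftrightarrow> linear_form a dvd p"
    and h: "\<And>p. homogeneous 1 p \<Longrightarrow> homogeneous 1 (subst g p)"
    using linear_form_quotient[OF a] by blast
  let ?g = "subst g" and ?c = "Poly_Mapping.single (0 :: 'n \<Rightarrow>\<^sub>0 nat) :: 'k \<Rightarrow> _"
  have minor: "?g x1 * ?g y2 = ?g x2 * ?g y1"
    using dvd g[of "x1 * y2 - x2 * y1"] by (simp add: subst_mult subst_diff)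
  have comb: "linear_form a dvd ?c s * u + ?c t * v \<longleftrightarrow> ?c s * ?g u + ?c t * ?g v = 0" for s t u v
    unfolding g[symmetric] by (simp add: subst_add subst_mult subst_const)
  show thesis
  proof (cases "?g x1 = 0")
    case True
    \<comment> \<open>A zero corner forces the whole first row or the whole first column to
      vanish.\<close>
    then have "?g x2 = 0 \<or> ?g y1 = 0" using minor mpoly_mult_eq_0[of "?g x2" "?g y1"] by simp
    then show thesis
      using True rows[of 1 0] columns[of 1 0] by (auto simp: comb g)
  next
    case False
    obtain b where b: "?g x1 = linear_form b" using homogeneous_1_linear_form[OF h[OF hom(1)]] .
    have "b \<noteq> 0" using False b by auto
    then have "?g x1 dvd ?g x2 \<or> ?g x1 dvd ?g y1"
      using linear_form_prime[of b "?g x2" "?g y1"] minor b by (metis dvd_triv_left)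
    then show thesis
    proof
      assume "?g x1 dvd ?g x2"
      then obtain k where k: "?g x2 = ?c k * ?g x1"
        using homogeneous_1_multiple[OF h h] hom by metis
      have "?g x1 * ?g y2 = ?g x1 * (?c k * ?g y1)" using minor k by (simp add: ac_simps)
      then have "?g y2 = ?c k * ?g y1" using False mpoly_mult_left_cancel by blast
      then show thesis using k columns[of "- k" 1] unfolding comb by (simp add: single_uminus)
    next
      assume "?g x1 dvd ?g y1"
      then obtain k where k: "?g y1 = ?c k * ?g x1"
        using homogeneous_1_multiple[OF h h] hom by metis
      have "?g x1 * ?g y2 = ?g x1 * (?c k * ?g x2)" using minor k by (simp add: ac_simps)
      then have "?g y2 = ?c k * ?g x2" using False mpoly_mult_left_cancel by blast
      then show thesis using k rows[of "- k" 1] unfolding comb by (simp add: single_uminus)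
    qed
  qed
qed

section \<open>Free submodules\<close>

text \<open>Gaussian elimination without division: a nonzero pivot \<open>v i0 j0\<close> clears
  coordinate \<open>j0\<close> by cross-multiplication, and the remaining vectors have one
  coordinate fewer.\<close>

lemma mpoly_dependent:
  fixes v :: "'i \<Rightarrow> 'j \<Rightarrow> ('n::finite, 'k::idom) mpoly"
  assumes "finite J" "finite I" "card J < card I"
  shows "\<exists>c. (\<exists>i\<in>I. c i \<noteq> 0) \<and> (\<forall>j\<in>J. (\<Sum>i\<in>I. c i * v i j) = 0)"
  using assms
proof (induction J arbitrary: I v rule: finite_induct)
  case empty
  then show ?case by (intro exI[of _ "\<lambda>_. 1"]) (auto simp: card_gt_0_iff)
next
  case (insert j0 J)
  show ?case
  proof (cases "\<forall>i\<in>I. v i j0 = 0")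
    case True
    have "card J < card I" using insert by simp
    then obtain c where "\<exists>i\<in>I. c i \<noteq> 0" "\<forall>j\<in>J. (\<Sum>i\<in>I. c i * v i j) = 0"
      using insert.IH[OF insert.prems(1), of v] by blast
    then show ?thesis using True by (intro exI[of _ c]) auto
  next
    case False
    then obtain i0 where i0: "i0 \<in> I" "v i0 j0 \<noteq> 0" by blast
    let ?I = "I - {i0}" and ?v = "\<lambda>i j. v i0 j0 * v i j - v i j0 * v i0 j"
    have "card J < card ?I" using insert i0 by simp
    then obtain c where c: "\<exists>i\<in>?I. c i \<noteq> 0" "\<forall>j\<in>J. (\<Sum>i\<in>?I. c i * ?v i j) = 0"
      using insert.IH[of ?I ?v] insert.prems(1) by auto
    \<comment> \<open>The relation among the reduced vectors is rewritten in the original ones; the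
      coefficient at \<open>i0\<close> collects what was subtracted from the others.\<close>
    define c' where "c' i = (if i = i0 then - (\<Sum>i\<in>?I. c i * v i j0) else v i0 j0 * c i)" for i
    have "(\<Sum>i\<in>I. c' i * v i j) = (\<Sum>i\<in>?I. c i * ?v i j)" for j
    proof -
      have "(\<Sum>i\<in>I. c' i * v i j) = c' i0 * v i0 j + (\<Sum>i\<in>?I. c' i * v i j)"
        using insert.prems(1) i0(1) by (rule sum.remove)
      also have "(\<Sum>i\<in>?I. c' i * v i j) = (\<Sum>i\<in>?I. c i * (v i0 j0 * v i j))"
        by (intro sum.cong) (auto simp: c'_def ac_simps)
      finally show ?thesis
        by (simp add: c'_def right_diff_distrib sum_subtractf sum_distrib_left ac_simps)
    qed
    moreover have "(\<Sum>i\<in>?I. c i * ?v i j0) = 0" by (simp add: mult.commute)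
    moreover have "\<exists>i\<in>I. c' i \<noteq> 0"
    proof -
      obtain i where i: "i \<in> I" "i \<noteq> i0" "c i \<noteq> 0" using c(1) by blast
      then have "c' i \<noteq> 0" using mpoly_mult_eq_0[of "v i0 j0" "c i"] i0(2) by (auto simp: c'_def)
      then show ?thesis using i(1) by blast
    qed
    ultimately show ?thesis using c(2) by (intro exI[of _ c']) auto
  qed
qed

section \<open>Bases indexed by the variables\<close>

definition lincomb :: "('n::finite \<Rightarrow> 'a::comm_ring_1 ^ 'm) \<Rightarrow> ('n \<Rightarrow> 'a) \<Rightarrow> 'a ^ 'm" where
  "lincomb \<theta> c = (\<Sum>i\<in>UNIV. c i *s \<theta> i)"

text \<open>The index type \<open>'n\<close> fixes the rank at \<open>CARD('n)\<close>, so that two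
  nested modules of this kind are compared by a square matrix.\<close>

definition module_basis :: "('n::finite \<Rightarrow> 'a::comm_ring_1 ^ 'n) \<Rightarrow> ('a ^ 'n) set \<Rightarrow> bool" where
  "module_basis \<theta> M \<longleftrightarrow> range (lincomb \<theta>) = M \<and> (\<forall>c. lincomb \<theta> c = 0 \<longrightarrow> (\<forall>i. c i = 0))"

lemma lincomb_nth: "lincomb \<theta> c $ j = (\<Sum>i\<in>UNIV. c i * \<theta> i $ j)"
  by (simp add: lincomb_def)

lemma lincomb_add: "lincomb \<theta> (\<lambda>i. c i + d i) = lincomb \<theta> c + lincomb \<theta> d"
  by (simp add: vec_eq_iff lincomb_nth distrib_right sum.distrib)

lemma lincomb_diff: "lincomb \<theta> (\<lambda>i. c i - d i) = lincomb \<theta> c - lincomb \<theta> d"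
  by (simp add: vec_eq_iff lincomb_nth left_diff_distrib sum_subtractf)

lemma lincomb_scale: "lincomb \<theta> (\<lambda>i. r * c i) = r *s lincomb \<theta> c"
  by (simp add: vec_eq_iff lincomb_nth sum_distrib_left mult.assoc)

lemma lincomb_lincomb: "lincomb (\<lambda>i. lincomb \<theta> (u i)) c = lincomb \<theta> (\<lambda>j. \<Sum>i\<in>UNIV. c i * u i j)"
proof -
  have "(\<Sum>i\<in>UNIV. c i * (\<Sum>j\<in>UNIV. u i j * \<theta> j $ k)) =
      (\<Sum>j\<in>UNIV. (\<Sum>i\<in>UNIV. c i * u i j) * \<theta> j $ k)" for k
    unfolding sum_distrib_left sum_distrib_right by (subst sum.swap) (simp add: mult.assoc)
  then show ?thesis by (simp add: vec_eq_iff lincomb_nth)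
qed

lemma lincomb_unit: "lincomb \<theta> (\<lambda>i. if i = k then r else 0) = r *s \<theta> k"
proof -
  have "lincomb \<theta> (\<lambda>i. if i = k then r else 0) = (\<Sum>i\<in>UNIV. if i = k then r *s \<theta> k else 0)"
    unfolding lincomb_def by (intro sum.cong) auto
  then show ?thesis by simp
qed

lemma lincomb_mem:
  assumes "module.subspace (*s) M" "\<And>i. \<theta> i \<in> M"
  shows "lincomb \<theta> c \<in> M"
  unfolding lincomb_def
  by (intro module.subspace_sum[OF module_vec assms(1)] module.subspace_scale[OF module_vec assms(1)] assms(2))

lemma module_basis_mem: "module_basis \<theta> M \<Longrightarrow> lincomb \<theta> c \<in> M"
  by (auto simp: module_basis_def)

lemma module_basis_nth_mem: "module_basis \<theta> M \<Longrightarrow> \<theta> i \<in> M"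
  using lincomb_unit[of \<theta> i 1] module_basis_mem[of \<theta> M "\<lambda>k. if k = i then 1 else 0"] by simp

lemma module_basis_obtain:
  assumes "module_basis \<theta> M" "m \<in> M"
  obtains c where "m = lincomb \<theta> c"
  using assms by (auto simp: module_basis_def)

lemma module_basis_unique:
  assumes "module_basis \<theta> M" "lincomb \<theta> c = lincomb \<theta> d"
  shows "c i = d i"
proof -
  have "lincomb \<theta> (\<lambda>i. c i - d i) = 0" using assms(2) by (simp add: lincomb_diff)
  then have "c i - d i = 0" using assms(1) unfolding module_basis_def by blast
  then show ?thesis by simp
qed

lemma module_basisI:
  assumes "module.subspace (*s) M" "\<And>i. \<theta> i \<in> M" "\<And>m. m \<in> M \<Longrightarrow> \<exists>c. m = lincomb \<theta> c"
    "\<And>c i. lincomb \<theta> c = 0 \<Longrightarrow> c i = 0"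
  shows "module_basis \<theta> M"
proof -
  have "lincomb \<theta> c \<in> M" for c using assms(1,2) by (rule lincomb_mem)
  then have "range (lincomb \<theta>) = M" using assms(3) by blast
  then show ?thesis unfolding module_basis_def using assms(4) by blast
qed

lemma module_basis_imp_free:
  fixes \<theta> :: "'n::finite \<Rightarrow> 'a::comm_ring_1 ^ 'n"
  assumes "module_basis \<theta> M"
  shows "free_submodule M"
proof -
  interpret module "(*s) :: 'a \<Rightarrow> 'a ^ 'n \<Rightarrow> 'a ^ 'n" by (rule module_vec)
  have inj: "inj \<theta>"
  proof (rule injI)
    fix i j assume "\<theta> i = \<theta> j"
    then have "lincomb \<theta> (\<lambda>k. if k = i then 1 else 0) = lincomb \<theta> (\<lambda>k. if k = j then 1 else 0)"
      by (simp add: lincomb_unit)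
    from module_basis_unique[OF assms this, of i] show "i = j" by (auto split: if_splits)
  qed
  have sum: "(\<Sum>v\<in>range \<theta>. u v *s v) = lincomb \<theta> (u \<circ> \<theta>)" for u
    by (simp add: lincomb_def sum.reindex[OF inj])
  have "\<not> dependent (range \<theta>)"
    unfolding dependent_finite[OF finite_imageI[OF finite]] sum
    using assms by (auto simp: module_basis_def)
  moreover have "span (range \<theta>) = M"
  proof -
    have "lincomb \<theta> c = lincomb \<theta> ((c \<circ> inv \<theta>) \<circ> \<theta>)" for c
      using inj by (simp add: comp_def)
    then have "range (\<lambda>u. lincomb \<theta> (u \<circ> \<theta>)) = range (lincomb \<theta>)" by blast
    then show ?thesis
      unfolding span_finite[OF finite_imageI[OF finite]] sum using assms by (simp add: module_basis_def)
  qed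
  ultimately show ?thesis unfolding free_submodule_def by blast
qed

text \<open>The basis has exactly \<open>CARD('n)\<close> members: more would be dependent in the
  ambient free module, and fewer would make the vectors \<open>q *s axis i 1\<close>
  dependent.\<close>

lemma free_imp_module_basis:
  fixes M :: "(('n::finite, 'k::idom) mpoly ^ 'n) set"
  assumes "free_submodule M" and q: "q \<noteq> 0" "\<And>i. q *s axis i 1 \<in> M"
  obtains \<theta> where "module_basis \<theta> M"
proof -
  interpret module "(*s) :: ('n, 'k) mpoly \<Rightarrow> ('n, 'k) mpoly ^ 'n \<Rightarrow> ('n, 'k) mpoly ^ 'n" by (rule module_vec)
  obtain B where B: "\<not> dependent B" "span B = M"
    using assms(1) by (auto simp: free_submodule_def)
  have "card S \<le> CARD('n)" if S: "S \<subseteq> B" "finite S" for S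
  proof (rule ccontr)
    assume "\<not> card S \<le> CARD('n)"
    then obtain c where c: "\<exists>s\<in>S. c s \<noteq> 0" "\<forall>j. (\<Sum>s\<in>S. c s * s $ j) = 0"
      using mpoly_dependent[of "UNIV :: 'n set" S "\<lambda>s j. s $ j"] S by auto
    have "(\<Sum>s\<in>S. c s *s s) = 0" using c(2) by (simp add: vec_eq_iff)
    then show False using B(1) S c(1) by (auto dest: independentD)
  qed
  then have "finite B \<and> card B \<le> CARD('n)"
    by (intro finite_if_finite_subsets_card_bdd) blast
  then have fin: "finite B" and le: "card B \<le> CARD('n)" by auto
  have "CARD('n) \<le> card B"
  proof (rule ccontr)
    have "\<exists>u. q *s axis i 1 = (\<Sum>b\<in>B. u b *s b)" for i
      using q(2)[of i] B(2) span_finite[OF fin] by auto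
    then have "\<exists>u. \<forall>i. q *s axis i 1 = (\<Sum>b\<in>B. u i b *s b)" by (intro choice allI)
    then obtain u where u: "\<And>i. q *s axis i 1 = (\<Sum>b\<in>B. u i b *s b)" by blast
    assume "\<not> CARD('n) \<le> card B"
    then obtain c where c: "\<exists>i. c i \<noteq> 0" "\<forall>b\<in>B. (\<Sum>i\<in>UNIV. c i * u i b) = 0"
      using mpoly_dependent[of B "UNIV :: 'n set" u] fin by auto
    have "(\<Sum>i\<in>UNIV. (c i * q) *s axis i 1) = (\<Sum>i\<in>UNIV. \<Sum>b\<in>B. (c i * u i b) *s b)"
      by (simp only: scale_scale[symmetric] u scale_sum_right)
    also have "\<dots> = (\<Sum>b\<in>B. (\<Sum>i\<in>UNIV. c i * u i b) *s b)"
      by (subst sum.swap) (simp add: scale_sum_left)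
    also have "\<dots> = 0" using c(2) by (simp add: sum.neutral)
    finally have "c i * q = 0" for i
      by (simp add: vec_eq_iff axis_def if_distrib cong: if_cong)
    then show False using c(1) q(1) mpoly_mult_eq_0 by blast
  qed
  with le fin obtain \<theta> where \<theta>: "bij_betw \<theta> (UNIV :: 'n set) B"
    by (metis finite_same_card_bij finite order_antisym)
  then have inj: "inj \<theta>" and ran: "range \<theta> = B" by (auto simp: bij_betw_def)
  have sum: "(\<Sum>v\<in>B. u v *s v) = lincomb \<theta> (u \<circ> \<theta>)" for u
    by (simp add: lincomb_def sum.reindex[OF inj] flip: ran)
  have ext: "c = (c \<circ> inv \<theta>) \<circ> \<theta>" for c :: "'n \<Rightarrow> ('n, 'k) mpoly"
    using inj by (simp add: comp_def)
  have "module_basis \<theta> M"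
  proof (rule module_basisI)
    show "subspace M" using B(2) subspace_span by blast
    show "\<theta> i \<in> M" for i using B(2) ran span_superset[of B] by blast
    show "\<exists>c. m = lincomb \<theta> c" if "m \<in> M" for m
      using that B(2) span_finite[OF fin] sum by auto
    fix c :: "'n \<Rightarrow> ('n, 'k) mpoly" and i assume "lincomb \<theta> c = 0"
    then have "(\<Sum>v\<in>B. (c \<circ> inv \<theta>) v *s v) = 0" using sum ext[of c] by metis
    then have "(c \<circ> inv \<theta>) (\<theta> i) = 0" using independentD[OF B(1) fin] ran by blast
    then show "c i = 0" using inj by simp
  qed
  then show thesis by (rule that)
qed

text \<open>In a relation with \<open>c i0\<close> nonzero, \<open>c i0\<close> times any element
  lies in the span of the other generators. These number one less than the rank, so the basis
  \<theta> would be dependent.\<close>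

lemma spanning_imp_module_basis:
  fixes \<theta> \<eta> :: "'n::finite \<Rightarrow> ('n, 'k::idom) mpoly ^ 'n"
  assumes \<theta>: "module_basis \<theta> M" and \<eta>: "range (lincomb \<eta>) = M"
  shows "module_basis \<eta> M"
proof -
  have "c i0 = 0" if c: "lincomb \<eta> c = 0" for c i0
  proof (rule ccontr)
    assume ne: "c i0 \<noteq> 0"
    have "\<exists>u. \<theta> i = lincomb \<eta> u" for i
      using module_basis_nth_mem[OF \<theta>, of i] \<eta> by blast
    then have "\<exists>u. \<forall>i. \<theta> i = lincomb \<eta> (u i)" by (intro choice allI)
    then obtain u where u: "\<And>i. \<theta> i = lincomb \<eta> (u i)" by blast
    \<comment> \<open>Subtracting \<open>u i i0\<close> times the relation makes the coordinate at
      \<open>i0\<close> zero.\<close>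
    define v where "v i j = c i0 * u i j - u i i0 * c j" for i j
    have v: "lincomb \<eta> (v i) = c i0 *s \<theta> i" for i
      using c by (simp add: v_def[abs_def] lincomb_diff lincomb_scale flip: u)
    obtain e where e: "\<exists>i. e i \<noteq> 0" "\<And>j. j \<noteq> i0 \<Longrightarrow> (\<Sum>i\<in>UNIV. e i * v i j) = 0"
      using mpoly_dependent[of "UNIV - {i0}" UNIV v] by (auto simp: card_Diff_singleton)
    have "(\<Sum>i\<in>UNIV. e i * v i j) = 0" for j
      using e(2)[of j] by (cases "j = i0") (simp_all add: v_def mult.commute)
    then have "lincomb (\<lambda>i. lincomb \<eta> (v i)) e = 0"
      unfolding lincomb_lincomb by (simp add: lincomb_def)
    then have "lincomb \<theta> (\<lambda>i. e i * c i0) = 0"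
      unfolding v by (simp add: lincomb_def)
    then have "e i * c i0 = 0" for i using \<theta> by (auto simp: module_basis_def)
    then show False using e(1) ne mpoly_mult_eq_0 by blast
  qed
  then show ?thesis using \<eta> by (auto simp: module_basis_def)
qed

section \<open>Homogeneous bases\<close>

text \<open>For derivations this is the grading by polynomial degree, in which each partial
  derivative has degree 0.\<close>

definition vhcomp :: "nat \<Rightarrow> ('n::finite, 'k::comm_ring_1) mpoly ^ 'm \<Rightarrow> ('n, 'k) mpoly ^ 'm" where
  "vhcomp d v = (\<chi> i. hcomp d (v $ i))"

lemma vhcomp_nth [simp]: "vhcomp d v $ i = hcomp d (v $ i)"
  by (simp add: vhcomp_def)

lemma vhcomp_add: "vhcomp d (v + w) = vhcomp d v + vhcomp d w"
  by (simp add: vec_eq_iff hcomp_add)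

lemma vhcomp_sum: "vhcomp d (\<Sum>i\<in>I. v i) = (\<Sum>i\<in>I. vhcomp d (v i))"
  by (simp add: vec_eq_iff hcomp_sum)

lemma vhcomp_vhcomp: "vhcomp d (vhcomp e v) = (if d = e then vhcomp e v else 0)"
  by (simp add: vec_eq_iff hcomp_hcomp)

lemma vhcomp_scale: "vhcomp d (c *s v) = (\<Sum>i\<le>d. hcomp i c *s vhcomp (d - i) v)"
  by (simp add: vec_eq_iff hcomp_mult)

lemma vhcomp_decomposition:
  fixes v :: "('n::finite, 'k::comm_ring_1) mpoly ^ 'm::finite"
  obtains D where "v = (\<Sum>d\<le>D. vhcomp d v)"
proof -
  have "\<exists>D. \<forall>i. \<forall>D'\<ge>D i. v $ i = (\<Sum>d\<le>D'. hcomp d (v $ i))"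
    by (intro choice allI hcomp_decomposition)
  then obtain D where D: "\<And>i D'. D i \<le> D' \<Longrightarrow> v $ i = (\<Sum>d\<le>D'. hcomp d (v $ i))" by blast
  have "v $ i = (\<Sum>d\<le>Max (range D). hcomp d (v $ i))" for i
    by (rule D) simp
  then show thesis by (intro that[of "Max (range D)"]) (simp add: vec_eq_iff)
qed

text \<open>The guard \<open>d i \<le> e\<close> is essential: truncated subtraction would otherwise
  let in the constant terms of coefficients of generators of too high degree.\<close>

lemma vhcomp_lincomb:
  assumes "\<And>i. vhcomp (d i) (\<theta> i) = \<theta> i"
  shows "vhcomp e (lincomb \<theta> c) = lincomb \<theta> (\<lambda>i. if d i \<le> e then hcomp (e - d i) (c i) else 0)"
proof -
  have "homogeneous (d i) (\<theta> i $ j)" for i j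
    using assms[of i] by (metis homogeneous_def vhcomp_nth)
  from hcomp_mult_homogeneous[OF this] show ?thesis
    by (auto simp: vec_eq_iff lincomb_nth hcomp_sum intro!: sum.cong)
qed

definition graded_submodule :: "(('n::finite, 'k::comm_ring_1) mpoly ^ 'n) set \<Rightarrow> bool" where
  "graded_submodule M \<longleftrightarrow> module.subspace (*s) M \<and> (\<forall>m\<in>M. \<forall>d. vhcomp d m \<in> M)"

definition homogeneous_basis ::
    "('n::finite \<Rightarrow> ('n, 'k::comm_ring_1) mpoly ^ 'n) \<Rightarrow> ('n \<Rightarrow> nat) \<Rightarrow> (('n, 'k) mpoly ^ 'n) set \<Rightarrow> bool" where
  "homogeneous_basis \<theta> d M \<longleftrightarrow> module_basis \<theta> M \<and> (\<forall>i. vhcomp (d i) (\<theta> i) = \<theta> i)"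

lemma subspace_range_lincomb: "module.subspace (*s) (range (lincomb \<theta>))"
  unfolding module.subspace_def[OF module_vec]
proof (intro conjI ballI allI)
  show "0 \<in> range (lincomb \<theta>)" by (rule range_eqI[of _ _ "\<lambda>_. 0"]) (simp add: lincomb_def)
  show "x + y \<in> range (lincomb \<theta>)" if "x \<in> range (lincomb \<theta>)" "y \<in> range (lincomb \<theta>)" for x y
    using that by (auto simp flip: lincomb_add)
  show "r *s x \<in> range (lincomb \<theta>)" if "x \<in> range (lincomb \<theta>)" for r x
    using that by (auto simp flip: lincomb_scale)
qed

text \<open>Graded Nakayama: homogeneous elements whose coordinates have constant terms spanning
  \<open>'k ^ 'n\<close> generate the module, and as many generators as the rank form a basis.\<close>

lemma homogeneous_basis_exists:
  fixes \<theta> :: "'n::finite \<Rightarrow> ('n, 'k::field) mpoly ^ 'n"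
  assumes M: "graded_submodule M" and \<theta>: "module_basis \<theta> M"
  obtains \<eta> d where "homogeneous_basis \<eta> d M"
proof -
  have sub: "module.subspace (*s) M" and comp: "\<And>m d. m \<in> M \<Longrightarrow> vhcomp d m \<in> M"
    using M by (auto simp: graded_submodule_def)
  define co where "co m = (SOME c. m = lincomb \<theta> c)" for m
  have co: "lincomb \<theta> (co m) = m" if m: "m \<in> M" for m
  proof -
    obtain c where "m = lincomb \<theta> c" using module_basis_obtain[OF \<theta> m] .
    then have "m = lincomb \<theta> (co m)" unfolding co_def by (rule someI[of "\<lambda>c. m = lincomb \<theta> c"])
    then show ?thesis by (rule sym)
  qed
  have co_lincomb: "co (lincomb \<theta> c) = c" for c
    by (rule ext) (rule module_basis_unique[OF \<theta> co[OF module_basis_mem[OF \<theta>]]])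
  \<comment> \<open>This is reduction modulo the ideal of polynomials without constant term: the
    basis \<theta> identifies the quotient of \<open>M\<close> with \<open>'k ^ 'n\<close>.\<close>
  define \<chi>0 :: "('n, 'k) mpoly ^ 'n \<Rightarrow> 'k ^ 'n" where "\<chi>0 m = (\<chi> i. Poly_Mapping.lookup (co m i) 0)" for m
  have \<chi>0_lincomb: "\<chi>0 (lincomb \<theta> c) = (\<chi> i. Poly_Mapping.lookup (c i) 0)" for c
    by (simp add: \<chi>0_def co_lincomb)
  have \<chi>0_add: "\<chi>0 (m + m') = \<chi>0 m + \<chi>0 m'" if "m \<in> M" "m' \<in> M" for m m'
  proof -
    have "m + m' = lincomb \<theta> (\<lambda>i. co m i + co m' i)" using that by (simp add: lincomb_add co)
    then show ?thesis by (simp add: \<chi>0_lincomb) (simp add: \<chi>0_def vec_eq_iff lookup_add)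
  qed
  have \<chi>0_scale: "\<chi>0 (Poly_Mapping.single 0 r *s m) = r *s \<chi>0 m" if "m \<in> M" for r m
  proof -
    have "Poly_Mapping.single 0 r *s m = lincomb \<theta> (\<lambda>i. Poly_Mapping.single 0 r * co m i)"
      using that by (simp add: lincomb_scale co)
    moreover have "Poly_Mapping.lookup (Poly_Mapping.single 0 r * p) 0 = r * Poly_Mapping.lookup p 0"
      for p :: "('n, 'k) mpoly"
    proof -
      have "hcomp 0 (Poly_Mapping.single 0 r * p) = hcomp 0 (Poly_Mapping.single 0 r) * hcomp 0 p"
        by (simp add: hcomp_mult)
      then show ?thesis
        unfolding hcomp_const mult_single by (metis add_0 lookup_single_eq)
    qed
    ultimately show ?thesis by (simp add: \<chi>0_lincomb) (simp add: \<chi>0_def vec_eq_iff)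
  qed
  have \<chi>0_sum: "\<chi>0 (\<Sum>i\<in>I. m i) = (\<Sum>i\<in>I. \<chi>0 (m i))" if "finite I" "\<And>i. m i \<in> M" for I and m :: "'i \<Rightarrow> _"
    using that(1)
  proof (induction I rule: finite_induct)
    case empty
    show ?case using \<chi>0_lincomb[of "\<lambda>_. 0"] by (simp add: lincomb_def vec_eq_iff)
  next
    case (insert x I)
    have "(\<Sum>i\<in>I. m i) \<in> M" by (rule module.subspace_sum[OF module_vec sub]) (rule that(2))
    then show ?case using insert \<chi>0_add[OF that(2)] by simp
  qed
  define hom where "hom m \<longleftrightarrow> (\<exists>d. vhcomp d m = m)" for m :: "('n, 'k) mpoly ^ 'n"
  have hom_vhcomp: "hom (vhcomp d m)" for d m
    unfolding hom_def by (rule exI[of _ d]) (simp add: vhcomp_vhcomp)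
  define X where "X = {\<chi>0 m | m. m \<in> M \<and> hom m}"
  have axis: "axis i 1 \<in> vec.span X" for i
  proof -
    have \<theta>i: "\<theta> i \<in> M" using \<theta> by (rule module_basis_nth_mem)
    obtain D where D: "\<theta> i = (\<Sum>d\<le>D. vhcomp d (\<theta> i))" by (rule vhcomp_decomposition)
    have "axis i 1 = \<chi>0 (\<theta> i)"
      using \<chi>0_lincomb[of "\<lambda>j. if j = i then 1 else 0"]
      by (simp add: lincomb_unit vec_eq_iff axis_def lookup_one)
    also have "\<dots> = (\<Sum>d\<le>D. \<chi>0 (vhcomp d (\<theta> i)))"
      by (rule trans[OF arg_cong[OF D, of \<chi>0] \<chi>0_sum]) (simp_all add: comp[OF \<theta>i])
    also have "\<dots> \<in> vec.span X"
      using comp[OF \<theta>i] by (intro vec.span_sum vec.span_base) (auto simp: X_def hom_vhcomp)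
    finally show ?thesis .
  qed
  have spanX: "vec.span X = UNIV"
  proof -
    have "v \<in> vec.span X" for v
      by (subst basis_expansion[of v, symmetric]) (intro vec.span_sum vec.span_scale axis)
    then show ?thesis by blast
  qed
  obtain C where C: "C \<subseteq> X" "vec.independent C" "X \<subseteq> vec.span C"
    using vec.maximal_independent_subset by blast
  have spanC: "vec.span C = UNIV"
    using vec.span_minimal[OF C(3) vec.subspace_span] spanX by auto
  have finC: "finite C" using C(2) by (rule vec.finiteI_independent)
  have cardC: "card C = CARD('n)"
    using vec.dim_eq_card[of C UNIV] C(2) spanC vec.dim_UNIV by (simp add: card_cart_basis)
  obtain b where b: "bij_betw b (UNIV :: 'n set) C"
    using finite_same_card_bij[of "UNIV :: 'n set" C] finC cardC by auto
  have "\<exists>m. m \<in> M \<and> hom m \<and> b i = \<chi>0 m" for i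
  proof -
    have "b i \<in> X" using bij_betw_apply[OF b UNIV_I] C(1) by blast
    then show ?thesis unfolding X_def by blast
  qed
  then have "\<exists>\<eta>. \<forall>i. \<eta> i \<in> M \<and> hom (\<eta> i) \<and> b i = \<chi>0 (\<eta> i)"
    by (intro choice allI)
  then obtain \<eta> where \<eta>_all: "\<forall>i. \<eta> i \<in> M \<and> hom (\<eta> i) \<and> b i = \<chi>0 (\<eta> i)" ..
  then have \<eta>: "\<eta> i \<in> M" "hom (\<eta> i)" "b i = \<chi>0 (\<eta> i)" for i by simp_all
  have "\<exists>d. \<forall>i. vhcomp (d i) (\<eta> i) = \<eta> i" using \<eta>(2) unfolding hom_def by (intro choice allI)
  then obtain d where "\<forall>i. vhcomp (d i) (\<eta> i) = \<eta> i" ..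
  then have d: "vhcomp (d i) (\<eta> i) = \<eta> i" for i by (rule spec)
  have subr: "module.subspace (*s) (range (lincomb \<eta>))" by (rule subspace_range_lincomb)
  \<comment> \<open>Strong induction on the degree. A combination of the \<eta> with constant
    coefficients matches \<open>m\<close> under \<open>\<chi>0\<close>; the difference has
    \<theta>-coordinates without constant term, so its degree \<open>e\<close> part involves only
    components of the \<theta> of degree below \<open>e\<close>.\<close>
  have hom_range: "m \<in> range (lincomb \<eta>)" if "m \<in> M" "vhcomp e m = m" for m e
    using that
  proof (induction e arbitrary: m rule: less_induct)
    case (less e)
    have "\<chi>0 m \<in> range (\<lambda>u. \<Sum>v\<in>C. u v *s v)"
      using spanC vec.span_finite[OF finC] by auto
    then obtain u where u: "\<chi>0 m = (\<Sum>v\<in>C. u v *s v)" by blast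
    define l where "l i = u (b i)" for i
    have "\<chi>0 m = (\<Sum>i\<in>UNIV. l i *s b i)"
      unfolding u l_def using sum.reindex_bij_betw[OF b, of "\<lambda>v. u v *s v"] by simp
    also have "\<dots> = \<chi>0 (lincomb \<eta> (\<lambda>i. Poly_Mapping.single 0 (l i)))"
      unfolding lincomb_def
      using \<chi>0_sum[of UNIV "\<lambda>i. Poly_Mapping.single 0 (l i) *s \<eta> i"] \<chi>0_scale \<eta>
        module.subspace_scale[OF module_vec sub] by simp
    finally have eq: "\<chi>0 m = \<chi>0 (lincomb \<eta> (\<lambda>i. Poly_Mapping.single 0 (l i)))" .
    define c where "c i = co m i - co (lincomb \<eta> (\<lambda>i. Poly_Mapping.single 0 (l i))) i" for i
    have const: "hcomp 0 (c i) = 0" for i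
      using eq by (simp add: c_def \<chi>0_def vec_eq_iff hcomp_const lookup_minus)
    have "lincomb \<theta> c = m - lincomb \<eta> (\<lambda>i. Poly_Mapping.single 0 (l i))"
      unfolding c_def lincomb_diff by (simp add: co less.prems(1) lincomb_mem[OF sub \<eta>(1)])
    then have "m = lincomb \<eta> (\<lambda>i. Poly_Mapping.single 0 (l i)) + lincomb \<theta> c" by simp
    then have m: "m = vhcomp e (lincomb \<eta> (\<lambda>i. Poly_Mapping.single 0 (l i))) + vhcomp e (lincomb \<theta> c)"
      using less.prems(2) by (metis vhcomp_add)
    have "hcomp k (c i) *s vhcomp (e - k) (\<theta> i) \<in> range (lincomb \<eta>)" if "k \<le> e" for i k
    proof (cases "k = 0")
      case True
      then show ?thesis using const module.subspace_0[OF module_vec subr] by simp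
    next
      case False
      then have "vhcomp (e - k) (\<theta> i) \<in> range (lincomb \<eta>)"
        using that comp module_basis_nth_mem[OF \<theta>] by (intro less.IH[of "e - k"]) (simp_all add: vhcomp_vhcomp)
      then show ?thesis by (rule module.subspace_scale[OF module_vec subr])
    qed
    then have "vhcomp e (lincomb \<theta> c) \<in> range (lincomb \<eta>)"
      unfolding lincomb_def[of \<theta>] vhcomp_sum vhcomp_scale
      by (intro module.subspace_sum[OF module_vec subr]) auto
    moreover have "vhcomp e (lincomb \<eta> (\<lambda>i. Poly_Mapping.single 0 (l i))) \<in> range (lincomb \<eta>)"
      by (simp add: vhcomp_lincomb[OF d])
    ultimately show ?case
      by (subst m) (rule module.subspace_add[OF module_vec subr])
  qed
  have "range (lincomb \<eta>) = M"
  proof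
    have "lincomb \<eta> c \<in> M" for c using sub \<eta>(1) by (rule lincomb_mem)
    then show "range (lincomb \<eta>) \<subseteq> M" by blast
    show "M \<subseteq> range (lincomb \<eta>)"
    proof
      fix m assume m: "m \<in> M"
      obtain D where D: "m = (\<Sum>d\<le>D. vhcomp d m)" by (rule vhcomp_decomposition)
      have "(\<Sum>d\<le>D. vhcomp d m) \<in> range (lincomb \<eta>)"
      proof (rule module.subspace_sum[OF module_vec subr])
        show "vhcomp k m \<in> range (lincomb \<eta>)" for k
          by (rule hom_range[of _ k]) (simp_all add: comp m vhcomp_vhcomp)
      qed
      then show "m \<in> range (lincomb \<eta>)" by (subst D)
    qed
  qed
  then have "homogeneous_basis \<eta> d M"
    using spanning_imp_module_basis[OF \<theta>] d by (simp add: homogeneous_basis_def)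
  then show thesis by (rule that)
qed

lemma lincomb_remove: "lincomb \<theta> c = c p *s \<theta> p + (\<Sum>i\<in>UNIV - {p}. c i *s \<theta> i)"
  unfolding lincomb_def by (rule sum.remove) auto

text \<open>The coefficient at \<open>p\<close> is a unit, so \<open>\<theta> p\<close> can be
  recovered from its replacement and the other members. The replacement is homogeneous of degree
  \<open>d p\<close>, so the list of degrees stays the same.\<close>

lemma homogeneous_basis_swap:
  fixes \<theta> :: "'n::finite \<Rightarrow> ('n, 'k::field) mpoly ^ 'n"
  assumes \<theta>: "homogeneous_basis \<theta> d M"
    and c: "c p = Poly_Mapping.single 0 k" "k \<noteq> 0"
    and hom: "vhcomp (d p) (lincomb \<theta> c) = lincomb \<theta> c"
  shows "homogeneous_basis (\<theta>(p := lincomb \<theta> c)) d M"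
proof -
  let ?\<theta> = "\<theta>(p := lincomb \<theta> c)"
  have basis: "module_basis \<theta> M" using \<theta> by (simp add: homogeneous_basis_def)
  have lc: "lincomb ?\<theta> u = lincomb \<theta> (\<lambda>i. if i = p then u p * c p else u i + u p * c i)" for u
  proof -
    have "lincomb ?\<theta> u = u p *s lincomb \<theta> c + (\<Sum>i\<in>UNIV - {p}. u i *s \<theta> i)"
      by (simp add: lincomb_remove[of ?\<theta> u p])
    also have "\<dots> = (u p * c p) *s \<theta> p + (\<Sum>i\<in>UNIV - {p}. (u i + u p * c i) *s \<theta> i)"
      by (simp add: lincomb_remove[of \<theta> c p] vec_eq_iff algebra_simps sum.distrib sum_distrib_left)
    also have "\<dots> = lincomb \<theta> (\<lambda>i. if i = p then u p * c p else u i + u p * c i)"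
      by (simp add: lincomb_remove[of \<theta> _ p])
    finally show ?thesis .
  qed
  have inv: "Poly_Mapping.single 0 (inverse k) * c p = 1"
    using c by (simp add: mult_single)
  have "lincomb \<theta> b = lincomb ?\<theta> (\<lambda>i. if i = p then b p * Poly_Mapping.single 0 (inverse k)
      else b i - b p * Poly_Mapping.single 0 (inverse k) * c i)" for b
    unfolding lc using inv by (intro arg_cong[of _ _ "lincomb \<theta>"]) (auto simp: mult.assoc)
  then have "range (lincomb \<theta>) \<subseteq> range (lincomb ?\<theta>)" by blast
  moreover have "range (lincomb ?\<theta>) \<subseteq> range (lincomb \<theta>)" using lc by blast
  ultimately have "range (lincomb ?\<theta>) = M" using basis by (simp add: module_basis_def)
  then show ?thesis
    using spanning_imp_module_basis[OF basis] \<theta> hom by (simp add: homogeneous_basis_def)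
qed

section \<open>Submodules cut out by one congruence\<close>

lemma dvd_diff_imp_dvd_iff:
  fixes a :: "'a::comm_ring_1"
  assumes "a dvd x - y"
  shows "a dvd x \<longleftrightarrow> a dvd y"
  using dvd_diff[OF _ assms, of x] dvd_add[OF assms, of y] by auto

text \<open>If the value at \<open>\<theta> p\<close> vanishes modulo the form, the submodule is all
  of \<open>M\<close>. Otherwise the form is prime to that value, and a basis is obtained from
  \<open>linear_form a *s \<theta> p\<close> and the differences
  \<open>\<theta> j - r j *s \<theta> p\<close> for \<open>j \<noteq> p\<close>.\<close>

lemma principal_image_imp_free:
  fixes a :: "'k::field ^ 'n::finite" and \<phi> :: "('n, 'k) mpoly ^ 'n \<Rightarrow> ('n, 'k) mpoly"
  assumes a: "a \<noteq> 0" and \<theta>: "module_basis \<theta> M" and M: "module.subspace (*s) M"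
    and \<phi>: "\<And>x y. \<phi> (x + y) = \<phi> x + \<phi> y" "\<And>c x. \<phi> (c *s x) = c * \<phi> x"
    and r: "\<And>j. linear_form a dvd \<phi> (\<theta> j) - r j * \<phi> (\<theta> p)"
  shows "free_submodule {m \<in> M. linear_form a dvd \<phi> m}"
proof -
  let ?a = "linear_form a"
  have \<phi>0: "\<phi> 0 = 0" using \<phi>(2)[of 0 0] by simp
  have \<phi>_sum: "\<phi> (\<Sum>i\<in>I. x i) = (\<Sum>i\<in>I. \<phi> (x i))" for I and x :: "'n \<Rightarrow> _"
    by (induction I rule: infinite_finite_induct) (auto simp: \<phi> \<phi>0)
  have \<phi>_lincomb: "\<phi> (lincomb \<theta> c) = (\<Sum>i\<in>UNIV. c i * \<phi> (\<theta> i))" for c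
    by (simp add: lincomb_def \<phi>_sum \<phi>)
  have sub: "module.subspace (*s) {m \<in> M. ?a dvd \<phi> m}"
    using M unfolding module.subspace_def[OF module_vec] by (auto simp: \<phi> \<phi>0)
  have cong: "?a dvd \<phi> (lincomb \<theta> c) - (\<Sum>i\<in>UNIV. c i * r i) * \<phi> (\<theta> p)" for c
  proof -
    have "\<phi> (lincomb \<theta> c) - (\<Sum>i\<in>UNIV. c i * r i) * \<phi> (\<theta> p) = (\<Sum>i\<in>UNIV. c i * (\<phi> (\<theta> i) - r i * \<phi> (\<theta> p)))"
      by (simp add: \<phi>_lincomb right_diff_distrib sum_subtractf sum_distrib_right mult.assoc)
    then show ?thesis using r by (simp add: dvd_sum)
  qed
  show ?thesis
  proof (cases "?a dvd \<phi> (\<theta> p)")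
    case True
    have "?a dvd \<phi> m" if "m \<in> M" for m
    proof -
      obtain c where "m = lincomb \<theta> c" using module_basis_obtain[OF \<theta> \<open>m \<in> M\<close>] .
      then show ?thesis using dvd_diff_imp_dvd_iff[OF cong[of c]] True by simp
    qed
    then have "{m \<in> M. ?a dvd \<phi> m} = M" by blast
    then show ?thesis using module_basis_imp_free[OF \<theta>] by simp
  next
    case False
    \<comment> \<open>The hypothesis at \<open>j = p\<close> does not fix \<open>r p\<close>; the
      value 1 is admissible there and gives \<open>c p\<close> coefficient 1 below.\<close>
    define r' where "r' = r(p := 1)"
    have r': "?a dvd \<phi> (\<theta> j) - r' j * \<phi> (\<theta> p)" for j using r by (simp add: r'_def)
    define \<eta> where "\<eta> j = (if j = p then ?a *s \<theta> p else \<theta> j - r j *s \<theta> p)" for j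
    have \<eta>: "lincomb \<eta> e = lincomb \<theta> (\<lambda>j. if j = p then e p * ?a - (\<Sum>j\<in>UNIV - {p}. e j * r j) else e j)" for e
      unfolding lincomb_remove[of _ _ p]
      by (simp add: \<eta>_def vec_eq_iff algebra_simps sum_subtractf sum_distrib_left)
    have "module_basis \<eta> {m \<in> M. ?a dvd \<phi> m}"
    proof (rule module_basisI[OF sub])
      fix j
      have "\<eta> j \<in> M"
        using module_basis_nth_mem[OF \<theta>] module.subspace_diff[OF module_vec M]
          module.subspace_scale[OF module_vec M] by (simp add: \<eta>_def)
      moreover have "?a dvd \<phi> (\<eta> j)"
      proof -
        have "\<phi> (x - y) = \<phi> x - \<phi> y" for x y using \<phi>(1)[of "x - y" y] by simp
        then show ?thesis using r by (simp add: \<eta>_def \<phi>)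
      qed
      ultimately show "\<eta> j \<in> {m \<in> M. ?a dvd \<phi> m}" by simp
    next
      fix m assume m: "m \<in> {m \<in> M. ?a dvd \<phi> m}"
      then obtain c where c: "m = lincomb \<theta> c" using module_basis_obtain[OF \<theta>] by blast
      have "\<phi> (lincomb \<theta> c) - (\<Sum>i\<in>UNIV. c i * r' i) * \<phi> (\<theta> p) = (\<Sum>i\<in>UNIV. c i * (\<phi> (\<theta> i) - r' i * \<phi> (\<theta> p)))"
        by (simp add: \<phi>_lincomb right_diff_distrib sum_subtractf sum_distrib_right mult.assoc)
      then have "?a dvd \<phi> (lincomb \<theta> c) - (\<Sum>i\<in>UNIV. c i * r' i) * \<phi> (\<theta> p)" using r' by (simp add: dvd_sum)
      then have "?a dvd (\<Sum>i\<in>UNIV. c i * r' i) * \<phi> (\<theta> p)"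
        using m c dvd_diff_imp_dvd_iff by blast
      then have "?a dvd (\<Sum>i\<in>UNIV. c i * r' i)" using linear_form_prime[OF a] False by blast
      moreover have "(\<Sum>i\<in>UNIV. c i * r' i) = c p + (\<Sum>i\<in>UNIV - {p}. c i * r i)"
        by (subst sum.remove[of _ p]) (auto simp: r'_def)
      ultimately obtain s where s: "c p + (\<Sum>i\<in>UNIV - {p}. c i * r i) = s * ?a"
        by (metis dvd_def mult.commute)
      have "m = lincomb \<eta> (c(p := s))"
        unfolding \<eta> c using s
        by (intro arg_cong[of _ _ "lincomb \<theta>"]) (auto simp: fun_eq_iff algebra_simps)
      then show "\<exists>c. m = lincomb \<eta> c" by blast
    next
      fix e i assume "lincomb \<eta> e = 0"
      then have z: "(if j = p then e p * ?a - (\<Sum>j\<in>UNIV - {p}. e j * r j) else e j) = 0" for j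
        using \<theta> unfolding \<eta> module_basis_def by blast
      then have ne: "e j = 0" if "j \<noteq> p" for j using that by (metis (mono_tags))
      have "e p * ?a = 0" using z[of p] ne by simp
      moreover have "?a \<noteq> 0" using a linear_form_eq_iff[of a 0] by simp
      ultimately have "e p = 0" using mpoly_mult_eq_0 by blast
      then show "e i = 0" using ne by (cases "i = p") auto
    qed
    then show ?thesis by (rule module_basis_imp_free)
  qed
qed

section \<open>The determinant of a submodule\<close>

lemma linear_form_dvd_const_multD:
  fixes a :: "'k::field ^ 'n::finite"
  assumes "k \<noteq> 0" "linear_form a dvd Poly_Mapping.single 0 k * p"
  shows "linear_form a dvd p"
proof -
  have "p = Poly_Mapping.single 0 (inverse k) * (Poly_Mapping.single 0 k * p)"
    using assms(1) by (simp add: mult_single flip: mult.assoc)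
  then show ?thesis using assms(2) by (metis dvd_mult)
qed

lemma linear_forms_dvd_mult:
  fixes a b :: "'k::field ^ 'n::finite"
  assumes "b \<noteq> 0" "\<not> linear_form b dvd linear_form a" "linear_form a dvd p" "linear_form b dvd p"
  obtains z where "p = z * (linear_form a * linear_form b)"
proof -
  obtain y where y: "p = linear_form a * y" using assms(3) by blast
  then have "linear_form b dvd y" using linear_form_prime[OF assms(1)] assms(2,4) by blast
  then obtain z where "y = linear_form b * z" by blast
  then show thesis using y that[of z] by (simp add: ac_simps)
qed

text \<open>Writing the dividend as \<open>q * s\<close>, each prime factor
  \<open>linear_form a\<close> is cancelled either from \<open>q\<close> or from
  \<open>s\<close>.\<close>

lemma dvd_linear_form_power_mult:
  fixes a :: "'k::field ^ 'n::finite"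
  assumes "a \<noteq> 0" "q dvd linear_form a ^ n * r"
  shows "\<exists>m q'. q = linear_form a ^ m * q' \<and> q' dvd r"
  using assms(2)
proof (induction n arbitrary: q)
  case 0
  then show ?case by (intro exI[of _ 0] exI[of _ q]) simp
next
  case (Suc n)
  let ?a = "linear_form a"
  have ne: "?a \<noteq> 0" using assms(1) linear_form_eq_iff[of a 0] by simp
  obtain s where s: "?a * (?a ^ n * r) = q * s" using Suc.prems by (auto simp: mult.assoc)
  then have "?a dvd q * s" by (metis dvd_triv_left)
  then consider q' where "q = ?a * q'" | s' where "s = ?a * s'"
    using linear_form_prime[OF assms(1), of q s] by blast
  then show ?case
  proof cases
    case 1
    have "?a * (?a ^ n * r) = ?a * (q' * s)" using s 1 by (simp add: ac_simps)
    then have "q' dvd ?a ^ n * r" using mpoly_mult_left_cancel[OF _ ne] by (metis dvd_triv_left)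
    then obtain m q'' where "q' = ?a ^ m * q''" "q'' dvd r" using Suc.IH by blast
    then show ?thesis using 1 by (intro exI[of _ "Suc m"] exI[of _ q'']) (simp add: mult.assoc)
  next
    case 2
    have "?a * (?a ^ n * r) = ?a * (q * s')" using s 2 by (simp add: ac_simps)
    then have "q dvd ?a ^ n * r" using mpoly_mult_left_cancel[OF _ ne] by (metis dvd_triv_left)
    then show ?thesis by (rule Suc.IH)
  qed
qed

lemma homogeneous_power: "homogeneous d p \<Longrightarrow> homogeneous (n * d) (p ^ n)"
proof (induction n)
  case 0
  show ?case by (simp add: homogeneous_def hcomp_const lookup_one)
qed (auto intro: homogeneous_mult)

text \<open>Here \<open>q\<close> is a unit times
  \<open>linear_form a ^ i * linear_form b ^ j\<close> with both exponents at most 1, and the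
  component in degree \<open>i + j\<close> is nonzero because the unit has nonzero constant
  term.\<close>

lemma order_le_2:
  fixes a b :: "'k::field ^ 'n::finite"
  assumes a: "a \<noteq> 0" and b: "b \<noteq> 0" and q: "q dvd linear_form a ^ m * linear_form b ^ n"
    and sq: "\<not> (linear_form a)\<^sup>2 dvd q" "\<not> (linear_form b)\<^sup>2 dvd q"
  obtains t where "t \<le> 2" "hcomp t q \<noteq> 0"
proof -
  let ?a = "linear_form a" and ?b = "linear_form b"
  obtain i q' where i: "q = ?a ^ i * q'" "q' dvd ?b ^ n"
    using dvd_linear_form_power_mult[OF a q] by blast
  obtain j u where j: "q' = ?b ^ j * u" "u dvd 1"
    using dvd_linear_form_power_mult[OF b, of q' n 1] i(2) by auto
  have "i < 2" using sq(1) i(1) le_imp_power_dvd[of 2 i ?a] by (metis dvd_mult2 not_le)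
  moreover have "j < 2"
  proof (rule ccontr)
    assume "\<not> j < 2"
    then have "?b\<^sup>2 dvd q'" using j(1) le_imp_power_dvd[of 2 j ?b] by simp
    then show False using sq(2) i(1) by simp
  qed
  moreover have "hcomp (i + j) q \<noteq> 0"
  proof -
    have hom: "homogeneous (i + j) (?a ^ i * ?b ^ j)"
      using homogeneous_mult[OF homogeneous_power homogeneous_power, OF homogeneous_linear_form homogeneous_linear_form] by simp
    have "q = u * (?a ^ i * ?b ^ j)" using i(1) j(1) by (simp add: ac_simps)
    then have "hcomp (i + j) q = hcomp 0 u * (?a ^ i * ?b ^ j)"
      by (simp add: hcomp_mult_homogeneous[OF hom])
    moreover have "hcomp 0 u \<noteq> 0"
    proof
      assume u: "hcomp 0 u = 0"
      obtain v where "1 = u * v" using j(2) by blast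
      moreover have "hcomp 0 (u * v) = hcomp 0 u * hcomp 0 v" by (simp add: hcomp_mult)
      ultimately have "hcomp 0 (1 :: ('n, 'k) mpoly) = hcomp 0 u * hcomp 0 v" by simp
      then show False using u by (simp add: hcomp_const lookup_one)
    qed
    moreover have "?a ^ i \<noteq> 0" "?b ^ j \<noteq> 0"
      using a b linear_form_eq_iff[of _ 0] by (auto intro!: mpoly_power_ne_0)
    ultimately show ?thesis by (metis mpoly_mult_eq_0)
  qed
  ultimately show thesis by (intro that[of "i + j"]) auto
qed

text \<open>A permutation that fixes every index except possibly \<open>p\<close> is the
  identity.\<close>

lemma det_diagonal_except_row:
  fixes C :: "'a::comm_ring_1 ^ 'n::finite ^ 'n"
  assumes "\<And>i j. i \<noteq> p \<Longrightarrow> i \<noteq> j \<Longrightarrow> C $ i $ j = 0"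
  shows "det C = (\<Prod>i\<in>UNIV. C $ i $ i)"
proof -
  let ?t = "\<lambda>\<pi>. of_int (sign \<pi>) * (\<Prod>i\<in>UNIV. C $ i $ \<pi> i)"
  have "?t \<pi> = 0" if \<pi>: "\<pi> permutes UNIV" "\<pi> \<noteq> id" for \<pi>
  proof -
    obtain i where "i \<noteq> p" "\<pi> i \<noteq> i"
    proof (rule ccontr)
      assume "\<not> thesis"
      then have fixed: "\<And>i. i \<noteq> p \<Longrightarrow> \<pi> i = i" using that by blast
      then have "\<pi> (\<pi> p) = \<pi> p" by (cases "\<pi> p = p") auto
      then have "\<pi> p = p" using permutes_inj[OF \<pi>(1)] by (auto dest: injD)
      then have "\<pi> i = i" for i using fixed by (cases "i = p") simp_all
      then show False using \<pi>(2) by (simp add: fun_eq_iff)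
    qed
    then have "C $ i $ \<pi> i = 0" using assms by metis
    then have "(\<Prod>i\<in>UNIV. C $ i $ \<pi> i) = 0" by (intro prod_zero) auto
    then show ?thesis by simp
  qed
  then have "det C = (\<Sum>\<pi>\<in>{id}. ?t \<pi>)"
    unfolding det_def by (intro sum.mono_neutral_right) (auto simp: permutes_id)
  then show ?thesis by simp
qed

text \<open>The solutions \<open>x\<close> are the columns of a matrix \<open>X\<close> with
  \<open>C = T ** X\<close>.\<close>

lemma det_dvd_of_columns:
  fixes C T :: "'a::comm_ring_1 ^ 'n::finite ^ 'n"
  assumes "\<And>j. \<exists>x. column j C = T *v x"
  shows "det T dvd det C"
proof -
  from assms have "\<exists>X. \<forall>j. column j C = T *v X j" by (intro choice allI)
  then obtain X where X: "\<forall>j. column j C = T *v X j" ..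
  have "C $ i $ j = (T ** (\<chi> k j. X j $ k)) $ i $ j" for i j
    using arg_cong[OF X[rule_format, of j], of "\<lambda>v. v $ i"]
    by (simp add: column_def matrix_vector_mult_def matrix_matrix_mult_def)
  then have "C = T ** (\<chi> k j. X j $ k)" by (simp add: vec_eq_iff)
  then show ?thesis by (simp add: det_mul)
qed

text \<open>By the hypothesis on \<open>T\<close>, its image contains all solutions of the two
  congruences. A test matrix \<open>C\<close> with such columns is exhibited; \<open>det T\<close>
  divides \<open>det C\<close>, which contains the factor \<open>linear_form a\<close> at most
  once.\<close>

lemma square_not_dvd_det:
  fixes a b :: "'k::field ^ 'n::finite" and T :: "('n, 'k) mpoly ^ 'n ^ 'n"
  assumes a: "a \<noteq> 0" and ab: "\<not> linear_form a dvd linear_form b"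
    and T: "\<And>c. linear_form a dvd (\<Sum>i\<in>UNIV. c $ i * f i) \<Longrightarrow> linear_form b dvd (\<Sum>i\<in>UNIV. c $ i * g i) \<Longrightarrow> \<exists>x. c = T *v x"
  shows "\<not> (linear_form a)\<^sup>2 dvd det T"
proof
  let ?a = "linear_form a" and ?b = "linear_form b"
  assume dvd: "?a\<^sup>2 dvd det T"
  have delta: "(\<Sum>i\<in>UNIV. (if i = j then r else 0) * h i) = r * h j" for r j and h :: "'n \<Rightarrow> ('n, 'k) mpoly"
    by (simp add: if_distrib[of "\<lambda>x. x * _"] cong: if_cong)
  show False
  proof (cases "\<forall>i. ?a dvd f i")
    case True
    \<comment> \<open>The first congruence always holds, so multiplying the unit vectors by
      \<open>?b\<close> suffices.\<close>
    define C :: "('n, 'k) mpoly ^ 'n ^ 'n" where "C = (\<chi> i j. if i = j then ?b else 0)"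
    have "\<exists>x. column j C = T *v x" for j
      using True by (intro T) (simp_all add: column_def C_def delta)
    then have "?a\<^sup>2 dvd det C" using det_dvd_of_columns dvd dvd_trans by blast
    also have "det C = ?b ^ CARD('n)"
      by (subst det_diagonal) (simp_all add: C_def)
    finally have "?a dvd ?b ^ CARD('n)" by (metis dvd_mult_left power2_eq_square)
    then show False using linear_form_prime_power[OF a] ab by blast
  next
    case False
    then obtain p where p: "\<not> ?a dvd f p" by blast
    \<comment> \<open>Column \<open>p\<close> is \<open>?a * ?b\<close> times a unit vector. Column
      \<open>j\<close> is \<open>?b\<close> times the syzygy with \<open>f p\<close> in place
      \<open>j\<close> and \<open>- f j\<close> in place \<open>p\<close>, which annihilates
      \<open>f\<close> exactly.\<close>
    define C :: "('n, 'k) mpoly ^ 'n ^ 'n" where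
      "C = (\<chi> i j. if j = p then (if i = p then ?a * ?b else 0)
         else (if i = j then ?b * f p else 0) - (if i = p then ?b * f j else 0))"
    have "\<exists>x. column j C = T *v x" for j
    proof (cases "j = p")
      case True
      then have "column j C $ i = (if i = p then ?a * ?b else 0)" for i by (simp add: column_def C_def)
      then show ?thesis by (intro T) (simp_all only: delta mult.assoc dvd_triv_left dvd_mult)
    next
      case False
      then have col: "column j C $ i = (if i = j then ?b * f p else 0) - (if i = p then ?b * f j else 0)" for i
        by (simp add: column_def C_def)
      have "(\<Sum>i\<in>UNIV. column j C $ i * h i) = ?b * (f p * h j - f j * h p)" for h
        unfolding col left_diff_distrib sum_subtractf delta by (simp add: right_diff_distrib mult.assoc)
      then show ?thesis by (intro T) (simp_all add: mult.commute)
    qed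
    then have "?a\<^sup>2 dvd det C" using det_dvd_of_columns dvd dvd_trans by blast
    also have "det C = (\<Prod>i\<in>UNIV. C $ i $ i)"
      by (rule det_diagonal_except_row[of p]) (auto simp: C_def)
    also have "\<dots> = ?a * (?b * (\<Prod>i\<in>UNIV - {p}. ?b * f p))"
      by (subst prod.remove[of _ p]) (auto simp: C_def mult.assoc intro!: prod.cong)
    also have "\<dots> = ?a * (?b * (?b * f p) ^ (CARD('n) - 1))" by (simp add: card_Diff_singleton)
    finally have "?a * ?a dvd ?a * (?b * (?b * f p) ^ (CARD('n) - 1))" by (simp add: power2_eq_square)
    then obtain z where "?a * (?b * (?b * f p) ^ (CARD('n) - 1)) = ?a * (?a * z)" by (auto simp: mult.assoc)
    moreover have "?a \<noteq> 0" using a linear_form_eq_iff[of a 0] by simp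
    ultimately have "?b * (?b * f p) ^ (CARD('n) - 1) = ?a * z" by (rule mpoly_mult_left_cancel)
    then have "?a dvd ?b * (?b * f p) ^ (CARD('n) - 1)" by simp
    then have "?a dvd (?b * f p) ^ (CARD('n) - 1)" using linear_form_prime[OF a] ab by blast
    then have "?a dvd ?b * f p" by (rule linear_form_prime_power[OF a])
    then show False using linear_form_prime[OF a] ab p by blast
  qed
qed

text \<open>After scaling row \<open>q\<close> by a nonzero entry of row \<open>p\<close>, the
  vanishing minors make it a multiple of row \<open>p\<close>.\<close>

lemma det_eq_0_of_minors:
  fixes T :: "('n::finite, 'k::idom) mpoly ^ 'm::finite ^ 'm"
  assumes pq: "p \<noteq> q" and minors: "\<And>j k. T $ p $ j * T $ q $ k = T $ p $ k * T $ q $ j"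
  shows "det T = 0"
proof (cases "\<forall>j. T $ p $ j = 0")
  case True
  then have "(\<Prod>i\<in>UNIV. T $ i $ \<pi> i) = 0" for \<pi> by (intro prod_zero) auto
  then show ?thesis by (simp add: det_def)
next
  case False
  then obtain j where j: "T $ p $ j \<noteq> 0" by blast
  have "T $ p $ j * det T = det (\<chi> i. if i = q then T $ p $ j *s T $ i else T $ i)"
    by (simp add: det_row_mul)
  also have "(\<chi> i. if i = q then T $ p $ j *s T $ i else T $ i) = (\<chi> i. if i = q then T $ q $ j *s T $ p else T $ i)"
    using minors by (auto simp: vec_eq_iff mult.commute)
  also have "det \<dots> = T $ q $ j * det (\<chi> i. if i = q then T $ p else T $ i)"
    by (rule det_row_mul)
  also have "det (\<chi> i. if i = q then T $ p else T $ i) = 0"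
    using pq by (intro det_identical_rows[OF pq]) (simp add: row_def vec_eq_iff)
  finally show ?thesis using mpoly_mult_eq_0 j by fastforce
qed

section \<open>Logarithmic derivations\<close>

lemma der_apply_add: "der_apply (x + y) f = der_apply x f + der_apply y f"
  by (simp add: der_apply_def distrib_right sum.distrib)

lemma der_apply_scale: "der_apply (c *s x) f = c * der_apply x f"
  by (simp add: der_apply_def sum_distrib_left mult.assoc)

lemma der_apply_lincomb: "der_apply (lincomb \<theta> c) f = (\<Sum>i\<in>UNIV. c i * der_apply (\<theta> i) f)"
proof -
  have "der_apply (\<Sum>i\<in>I. c i *s \<theta> i) f = (\<Sum>i\<in>I. c i * der_apply (\<theta> i) f)" for I
    by (induction I rule: infinite_finite_induct) (auto simp: der_apply_add der_apply_scale der_apply_def[of 0])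
  then show ?thesis by (simp add: lincomb_def)
qed

text \<open>The partial derivatives of a linear form are constants, so evaluation on it preserves
  degrees.\<close>

lemma hcomp_der_apply:
  fixes a :: "'k::comm_ring_1 ^ 'n::finite"
  shows "hcomp d (der_apply \<theta> (linear_form a)) = der_apply (vhcomp d \<theta>) (linear_form a)"
proof -
  have "homogeneous 0 (Poly_Mapping.single 0 c :: ('n, 'k) mpoly)" for c
    by (simp add: homogeneous_def hcomp_single mon_degree_eq_0)
  from hcomp_mult_homogeneous[OF this] show ?thesis
    by (simp add: der_apply_def partial_linear_form hcomp_sum)
qed

lemma homogeneous_dvd_hcomp:
  assumes "homogeneous e p" "p dvd q"
  shows "p dvd hcomp d q"
proof -
  obtain r where "q = r * p" using assms(2) by (metis dvd_def mult.commute)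
  then show ?thesis by (simp add: hcomp_mult_homogeneous[OF assms(1)])
qed

lemma defining_form_obtain:
  assumes "linear_hyperplane H"
  obtains a where "a \<noteq> 0" "form_kernel a = H" "defining_form H = linear_form a"
proof -
  obtain e where e: "e \<noteq> 0" "form_kernel e = H" using linear_hyperplane_form_kernel[OF assms] by blast
  define a where "a = (SOME a. form_kernel a = H)"
  have a: "form_kernel a = H" unfolding a_def using e(2) by (rule someI)
  obtain t where "e = t *s a" using form_kernel_eq_imp_proportional[of e a] e a by auto
  then have "a \<noteq> 0" using e(1) by auto
  then show thesis using a by (intro that[of a]) (simp_all add: defining_form_def a_def)
qed

lemma log_der_graded:
  assumes "arrangement A"
  shows "graded_submodule (log_der A)"
  unfolding graded_submodule_def
proof (intro conjI ballI allI log_der_submodule)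
  fix \<theta> d assume \<theta>: "\<theta> \<in> log_der A"
  have "defining_form H dvd der_apply (vhcomp d \<theta>) (defining_form H)" if H: "H \<in> A" for H
  proof -
    obtain a where a: "defining_form H = linear_form a"
      using defining_form_obtain assms H unfolding arrangement_def by metis
    have "linear_form a dvd der_apply \<theta> (linear_form a)" using \<theta> H a by (auto simp: log_der_def)
    then show ?thesis
      unfolding a hcomp_der_apply[symmetric] by (rule homogeneous_dvd_hcomp[OF homogeneous_linear_form])
  qed
  then show "vhcomp d \<theta> \<in> log_der A" by (simp add: log_der_def)
qed

text \<open>The product \<open>q\<close> of all defining forms multiplies every derivation into
  \<open>log_der A\<close>, which gives the full rank required.\<close>

lemma free_log_der_basis:
  fixes A :: "('k::field ^ 'n::finite) set set"
  assumes A: "arrangement A" and free: "free_arrangement A"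
  obtains \<theta> where "module_basis \<theta> (log_der A)"
proof -
  define q where "q = (\<Prod>H\<in>A. defining_form H)"
  have "q \<noteq> 0" unfolding q_def
  proof (rule mpoly_prod_ne_0)
    fix H assume "H \<in> A"
    then obtain a where "a \<noteq> 0" "defining_form H = linear_form a"
      using defining_form_obtain A unfolding arrangement_def by metis
    then show "defining_form H \<noteq> 0" using linear_form_eq_iff[of a 0] by simp
  qed
  moreover have "q *s axis i 1 \<in> log_der A" for i
    using A unfolding log_der_def arrangement_def
    by (auto simp: der_apply_scale q_def intro!: dvd_mult2 dvd_prodI)
  ultimately show thesis
    using free_imp_module_basis[OF free[unfolded free_arrangement_def]] that by blast
qed

lemma log_der_insert:
  "log_der (insert H A) = {\<theta> \<in> log_der A. defining_form H dvd der_apply \<theta> (defining_form H)}"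
  by (auto simp: log_der_def)

text \<open>\<open>M\<close> and \<open>N\<close> stand for the derivations of the arrangement
  without and with both hyperplanes. Either alternative is the hypothesis that
  \<open>principal_image_imp_free\<close> needs for one of the two forms.\<close>

lemma principal_image_exists:
  fixes a b :: "'k::field ^ 'n::finite" and M :: "('n, 'k) derivation set"
  assumes a: "a \<noteq> 0" and b: "b \<noteq> 0"
    and ab: "\<not> linear_form a dvd linear_form b" and ba: "\<not> linear_form b dvd linear_form a"
    and M: "graded_submodule M" and \<theta>0: "module_basis \<theta>0 M"
    and N_def: "N = {m \<in> M. linear_form a dvd der_apply m (linear_form a) \<and>
                            linear_form b dvd der_apply m (linear_form b)}"
    and \<psi>: "module_basis \<psi> N"
  obtains \<theta> r p where "module_basis \<theta> M"
    "(\<forall>j. linear_form a dvd der_apply (\<theta> j) (linear_form a) - r j * der_apply (\<theta> p) (linear_form a)) \<or>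
     (\<forall>j. linear_form b dvd der_apply (\<theta> j) (linear_form b) - r j * der_apply (\<theta> p) (linear_form b))"
proof -
  note goal = that
  let ?a = "linear_form a" and ?b = "linear_form b"
  let ?c = "Poly_Mapping.single (0 :: 'n \<Rightarrow>\<^sub>0 nat) :: 'k \<Rightarrow> _"
  have N_graded: "vhcomp e m \<in> N" if "m \<in> N" for e m
  proof -
    have m: "m \<in> M" "?a dvd der_apply m ?a" "?b dvd der_apply m ?b" using that by (simp_all add: N_def)
    then show ?thesis
      using M homogeneous_dvd_hcomp[OF homogeneous_linear_form m(2), of e] homogeneous_dvd_hcomp[OF homogeneous_linear_form m(3), of e]
      by (simp add: N_def graded_submodule_def hcomp_der_apply)
  qed
  obtain \<theta>1 d1 where "homogeneous_basis \<theta>1 d1 M" by (rule homogeneous_basis_exists[OF M \<theta>0])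
  then have ex: "homogeneous_basis (fst (\<theta>1, d1)) (snd (\<theta>1, d1)) M" by simp
  \<comment> \<open>The minimum is taken over pairs of a homogeneous basis and its degrees.\<close>
  obtain \<theta>d where \<theta>d: "homogeneous_basis (fst \<theta>d) (snd \<theta>d) M"
    and least: "\<forall>y. homogeneous_basis (fst y) (snd y) M \<longrightarrow> card {i. fst \<theta>d i \<notin> N} \<le> card {i. fst y i \<notin> N}"
    using ex_has_least_nat[where P = "\<lambda>x. homogeneous_basis (fst x) (snd x) M"
        and m = "\<lambda>x. card {i. fst x i \<notin> N}", OF ex] by blast
  define \<theta> d where "\<theta> = fst \<theta>d" and "d = snd \<theta>d"
  define P where "P = {i. \<theta> i \<notin> N}"
  have hb: "homogeneous_basis \<theta> d M" using \<theta>d by (simp add: \<theta>_def d_def)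
  have minimal: "card P \<le> card {i. \<theta>' i \<notin> N}" if "homogeneous_basis \<theta>' d' M" for \<theta>' d'
    using least[rule_format, of "(\<theta>', d')"] that by (simp add: P_def \<theta>_def)
  have \<theta>: "module_basis \<theta> M" and \<theta>hom: "\<And>i. vhcomp (d i) (\<theta> i) = \<theta> i"
    using hb by (simp_all add: homogeneous_basis_def)
  define f g where "f i = der_apply (\<theta> i) ?a" and "g i = der_apply (\<theta> i) ?b" for i
  have mem: "lincomb \<theta> c \<in> N \<longleftrightarrow> ?a dvd (\<Sum>i\<in>UNIV. c i * f i) \<and> ?b dvd (\<Sum>i\<in>UNIV. c i * g i)" for c
    using module_basis_mem[OF \<theta>] by (simp add: N_def der_apply_lincomb f_def g_def)
  have notP: "?a dvd f i" "?b dvd g i" if "i \<notin> P" for i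
    using that by (simp_all add: P_def N_def f_def g_def)
  have shift: "lincomb \<theta> (\<lambda>i. if d i \<le> e then hcomp (e - d i) (c i) else 0) \<in> N" if "lincomb \<theta> c \<in> N" for e c
    using N_graded[OF that, of e] by (simp add: vhcomp_lincomb[OF \<theta>hom])
  \<comment> \<open>Otherwise the component of degree \<open>d p\<close> of the given element lies
    in \<open>N\<close> and has a nonzero constant coefficient at \<open>p\<close>; exchanging it
    for \<open>\<theta> p\<close> leaves fewer members outside \<open>N\<close>.\<close>
  have const0: "hcomp 0 (c p) = 0" if c: "lincomb \<theta> c \<in> N" and p: "p \<in> P" for c p
  proof (rule ccontr)
    assume ne: "hcomp 0 (c p) \<noteq> 0"
    define c' where "c' i = (if d i \<le> d p then hcomp (d p - d i) (c i) else 0)" for i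
    define k where "k = Poly_Mapping.lookup (c p) 0"
    have eq: "lincomb \<theta> c' = vhcomp (d p) (lincomb \<theta> c)"
      unfolding c'_def by (rule vhcomp_lincomb[OF \<theta>hom, symmetric])
    have cp: "c' p = ?c k" "k \<noteq> 0" using ne by (auto simp: c'_def k_def hcomp_const)
    have "vhcomp (d p) (lincomb \<theta> c') = lincomb \<theta> c'" by (simp add: eq vhcomp_vhcomp)
    from homogeneous_basis_swap[OF hb cp this]
    have "card P \<le> card {i. (\<theta>(p := lincomb \<theta> c')) i \<notin> N}" by (rule minimal)
    moreover have "lincomb \<theta> c' \<in> N" unfolding eq by (rule N_graded[OF c])
    then have "{i. (\<theta>(p := lincomb \<theta> c')) i \<notin> N} = P - {p}" by (auto simp: P_def)
    moreover have "card (P - {p}) < card P" using p by (intro card_Diff1_less) auto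
    ultimately show False by simp
  qed
  have "\<exists>t. \<forall>j. \<psi> j = lincomb \<theta> (t j)"
  proof (intro choice allI)
    fix j
    have "\<psi> j \<in> M" using module_basis_nth_mem[OF \<psi>, of j] by (simp add: N_def)
    then show "\<exists>c. \<psi> j = lincomb \<theta> c" by (rule module_basis_obtain[OF \<theta>]) blast
  qed
  then obtain t where t_all: "\<forall>j. \<psi> j = lincomb \<theta> (t j)" ..
  then have t: "\<psi> j = lincomb \<theta> (t j)" for j by simp
  have tN: "lincomb \<theta> (t j) \<in> N" for j using module_basis_nth_mem[OF \<psi>, of j] by (simp add: t)
  \<comment> \<open>Column \<open>j\<close> holds the coordinates of \<open>\<psi> j\<close> in the
    basis \<theta>, so the image of \<open>T\<close> consists of the coordinate vectors of
    \<open>N\<close>.\<close>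
  define T :: "('n, 'k) mpoly ^ 'n ^ 'n" where "T = (\<chi> i j. t j i)"
  have T: "\<exists>x. c = T *v x" if c: "?a dvd (\<Sum>i\<in>UNIV. c $ i * f i)" "?b dvd (\<Sum>i\<in>UNIV. c $ i * g i)" for c
  proof -
    have "lincomb \<theta> (\<lambda>i. c $ i) \<in> N" using c by (simp add: mem)
    then obtain x where "lincomb \<theta> (\<lambda>i. c $ i) = lincomb \<psi> x" using module_basis_obtain[OF \<psi>] by blast
    also have "lincomb \<psi> x = lincomb (\<lambda>j. lincomb \<theta> (t j)) x" by (simp add: lincomb_def t)
    also have "\<dots> = lincomb \<theta> (\<lambda>i. \<Sum>j\<in>UNIV. x j * t j i)" by (rule lincomb_lincomb)
    finally have "c $ i = (\<Sum>j\<in>UNIV. x j * t j i)" for i by (rule module_basis_unique[OF \<theta>])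
    then show ?thesis
      by (intro exI[of _ "\<chi> j. x j"]) (simp add: vec_eq_iff matrix_vector_mult_def T_def mult.commute)
  qed
  obtain s where s: "s \<le> 2" "hcomp s (det T) \<noteq> 0"
  proof (rule order_le_2[OF a b])
    let ?C = "(\<chi> i j. if i = j then ?a * ?b else 0) :: ('n, 'k) mpoly ^ 'n ^ 'n"
    \<comment> \<open>Multiplication by \<open>?a * ?b\<close> carries \<open>M\<close> into
      \<open>N\<close>.\<close>
    have "det T dvd det ?C"
    proof (intro det_dvd_of_columns T dvd_sum)
      show "?a dvd column j ?C $ i * h" "?b dvd column j ?C $ i * h" for i j h
        by (simp_all add: column_def)
    qed
    also have "det ?C = ?a ^ CARD('n) * ?b ^ CARD('n)"
      by (subst det_diagonal) (simp_all add: power_mult_distrib)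
    finally show "det T dvd ?a ^ CARD('n) * ?b ^ CARD('n)" .
    show "\<not> ?a\<^sup>2 dvd det T" using a ab T by (rule square_not_dvd_det)
    show "\<not> ?b\<^sup>2 dvd det T" using b ba T by (rule square_not_dvd_det)
  qed
  define w :: "'n \<Rightarrow> nat" where "w i = (if i \<in> P then 1 else 0)" for i
  have low: "hcomp e (T $ i $ j) = 0" if "e < w i" for e i j
    using that const0[OF tN, of i j] by (auto simp: w_def T_def split: if_splits)
  have sumw: "sum w UNIV = card P" by (simp add: w_def[abs_def] sum.If_cases)
  \<comment> \<open>The initial form of \<open>T\<close>: linear parts in the rows from
    \<open>P\<close>, constant terms in the others.\<close>
  define T' :: "('n, 'k) mpoly ^ 'n ^ 'n" where "T' = (\<chi> i j. hcomp (w i) (T $ i $ j))"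
  have "\<not> s < card P" using hcomp_det_lowest(1)[where w = w and T = T and d = s, OF low] s(2) sumw by auto
  then have card2: "card P \<le> 2" using s(1) by simp
  \<comment> \<open>Members outside \<open>P\<close> take values divisible by \<open>?a\<close> and
    \<open>?b\<close>, so their multiplier can be 0; only \<open>q\<close> needs a relation to
    \<open>p\<close>.\<close>
  have principal: thesis if P: "P \<subseteq> {p, q}" and r: "?a dvd f q - r * f p \<or> ?b dvd g q - r * g p" for p q r
  proof (rule goal[OF \<theta>, of "\<lambda>j. if j = p then 1 else if j = q then r else 0" p])
    have "?a dvd f j" "?b dvd g j" if "j \<noteq> p" "j \<noteq> q" for j using that P by (auto intro: notP)
    then show "(\<forall>j. ?a dvd der_apply (\<theta> j) ?a - (if j = p then 1 else if j = q then r else 0) * der_apply (\<theta> p) ?a) \<or>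
      (\<forall>j. ?b dvd der_apply (\<theta> j) ?b - (if j = p then 1 else if j = q then r else 0) * der_apply (\<theta> p) ?b)"
      using r by (auto simp flip: f_def g_def)
  qed
  show thesis
  proof (cases "card P = 2")
    case False
    then have "card P \<le> 1" using card2 by simp
    then obtain p where "P \<subseteq> {p}"
      by (metis card_le_Suc0_iff_eq finite One_nat_def singleton_iff subsetI empty_iff)
    then show thesis using principal[of p p 1] by simp
  next
    case True
    then have "s = 2" using s(1) \<open>\<not> s < card P\<close> by simp
    then have detT': "det T' \<noteq> 0"
      using hcomp_det_lowest(2)[where w = w and T = T, OF low] s(2) sumw True by (simp add: T'_def)
    have two: thesis if P: "P = {p, q}" and pq: "p \<noteq> q" and dpq: "d p \<le> d q" for p q
    proof (rule ccontr)
      assume nt: "\<not> thesis"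
      have f_ne: "\<not> ?a dvd f q - r * f p" "\<not> ?a dvd f p - r * f q"
        and g_ne: "\<not> ?b dvd g q - r * g p" "\<not> ?b dvd g p - r * g q" for r
        using principal[of p q r] principal[of q p r] nt P by auto
      have nz: "\<not> ?a dvd f p" "\<not> ?a dvd f q" "\<not> ?b dvd g p" "\<not> ?b dvd g q"
        using f_ne[of 0] g_ne[of 0] by simp_all
      define x y where "x j = hcomp 1 (t j p)" and "y j = hcomp 1 (t j q)" for j
      have hom: "homogeneous 1 (x j)" "homogeneous 1 (y j)" for j
        by (simp_all only: x_def y_def homogeneous_hcomp)
      have "\<exists>j k. T' $ p $ j * T' $ q $ k \<noteq> T' $ p $ k * T' $ q $ j"
        using det_eq_0_of_minors[OF pq] detT' by metis
      then obtain j k where "T' $ p $ j * T' $ q $ k \<noteq> T' $ p $ k * T' $ q $ j" by blast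
      then have D: "x j * y k - x k * y j \<noteq> 0" using P by (simp add: T'_def T_def x_def y_def w_def)
      have pair: "?a dvd c p * f p + c q * f q" "?b dvd c p * g p + c q * g q" if c: "lincomb \<theta> c \<in> N" for c
      proof -
        have split: "(\<Sum>i\<in>UNIV. c i * h i) = (c p * h p + c q * h q) + (\<Sum>i\<in>UNIV - P. c i * h i)" for h
          using pq P sum.subset_diff[of P UNIV "\<lambda>i. c i * h i"] by simp
        have "?a dvd (\<Sum>i\<in>UNIV - P. c i * f i)" "?b dvd (\<Sum>i\<in>UNIV - P. c i * g i)"
          using notP by (auto intro!: dvd_sum)
        then show "?a dvd c p * f p + c q * f q" "?b dvd c p * g p + c q * g q"
          using c unfolding mem split by (simp_all add: dvd_add_left_iff)
      qed
      \<comment> \<open>This is the component of degree \<open>d p + 1\<close>. At \<open>q\<close>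
        it contributes \<open>y j\<close> for equal degrees, the vanishing constant term if
        \<open>d q = d p + 1\<close>, and nothing if \<open>d q\<close> is larger.\<close>
      have rel: "?a dvd x j * f p + (if d p = d q then y j else 0) * f q"
        "?b dvd x j * g p + (if d p = d q then y j else 0) * g q" for j
      proof -
        have "hcomp 0 (t j q) = 0" using const0[OF tN] P by simp
        then have "(if d q \<le> d p + 1 then hcomp (d p + 1 - d q) (t j q) else 0) = (if d p = d q then y j else 0)"
          using dpq by (auto simp: y_def le_Suc_eq)
        then show "?a dvd x j * f p + (if d p = d q then y j else 0) * f q"
          "?b dvd x j * g p + (if d p = d q then y j else 0) * g q"
          using pair[OF shift[OF tN[of j], of "d p + 1"]] by (simp_all add: x_def)
      qed
      show False
      proof (cases "d p = d q")
        case False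
        \<comment> \<open>With distinct degrees the relations force both forms to divide the linear
          \<open>x j\<close>; a multiple of \<open>?a * ?b\<close> has no component of degree
          1.\<close>
        have "x j = 0" for j
        proof -
          have "?a dvd x j" "?b dvd x j"
            using rel[of j] False nz linear_form_prime[OF a, of "x j"] linear_form_prime[OF b, of "x j"] by auto
          then obtain z where z: "x j = z * (?a * ?b)" using linear_forms_dvd_mult[OF b ba] by blast
          have "homogeneous (1 + 1) (?a * ?b)" by (intro homogeneous_mult homogeneous_linear_form)
          from hcomp_mult_homogeneous[OF this, of 1 z] have "hcomp 1 (x j) = 0" by (simp add: z)
          then show ?thesis using hom(1)[of j] by (simp add: homogeneous_def)
        qed
        then show False using D by simp
      next
        case True
        have relf: "?a dvd x j * f p + y j * f q" and relg: "?b dvd x j * g p + y j * g q" for j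
          using rel[of j] True by simp_all
        let ?D = "x j * y k - x k * y j"
        \<comment> \<open>Cramer's rule eliminates \<open>f q\<close> from the relations for
          \<open>j\<close> and \<open>k\<close>.\<close>
        have "?a dvd ?D * f p"
        proof -
          have "?D * f p = y k * (x j * f p + y j * f q) - y j * (x k * f p + y k * f q)" by (simp add: algebra_simps)
          then show ?thesis using relf by (simp only:) (intro dvd_diff dvd_mult; simp)
        qed
        then have aD: "?a dvd ?D" using linear_form_prime[OF a] nz by blast
        have "?b dvd ?D * g p"
        proof -
          have "?D * g p = y k * (x j * g p + y j * g q) - y j * (x k * g p + y k * g q)" by (simp add: algebra_simps)
          then show ?thesis using relg by (simp only:) (intro dvd_diff dvd_mult; simp)
        qed
        then have bD: "?b dvd ?D" using linear_form_prime[OF b] nz by blast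
        obtain z where z: "?D = z * (?a * ?b)" using linear_forms_dvd_mult[OF b ba aD bD] .
        have "homogeneous (1 + 1) (?a * ?b)" by (intro homogeneous_mult homogeneous_linear_form)
        then have "homogeneous 2 (?a * ?b)" by (simp only: one_add_one)
        from hcomp_mult_homogeneous[OF this, of 2 z] have "hcomp 2 ?D = hcomp 0 z * (?a * ?b)" unfolding z by simp
        moreover have "homogeneous (1 + 1) (x j * y k)" "homogeneous (1 + 1) (x k * y j)"
          by (intro homogeneous_mult hom)+
        then have "hcomp 2 ?D = ?D" by (simp add: homogeneous_def hcomp_diff numeral_2_eq_2)
        \<comment> \<open>Both sides have degree 2, so the cofactor of \<open>?a * ?b\<close> is a
          constant.\<close>
        ultimately have D': "?D = ?c (Poly_Mapping.lookup z 0) * (?a * ?b)" by (simp add: hcomp_const)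
        have k0: "Poly_Mapping.lookup z 0 \<noteq> 0" using D D' by auto
        have not_all: False if "?a dvd x j" "?a dvd x k" "?a dvd y j" "?a dvd y k"
        proof -
          have "?a * ?a dvd ?D" using that by (intro dvd_diff mult_dvd_mono)
          then obtain u where "?D = ?a * ?a * u" ..
          then have "?a * (?c (Poly_Mapping.lookup z 0) * ?b) = ?a * (?a * u)" using D' by (simp add: ac_simps)
          moreover have "?a \<noteq> 0" using a linear_form_eq_iff[of a 0] by simp
          ultimately have "?c (Poly_Mapping.lookup z 0) * ?b = ?a * u" by (rule mpoly_mult_left_cancel)
          then have "?a dvd ?c (Poly_Mapping.lookup z 0) * ?b" by simp
          then show False using linear_form_dvd_const_multD[OF k0] ab by blast
        qed
        show False
        proof (rule linear_2x2_minor_dvd[OF a hom(1)[of j] hom(1)[of k] hom(2)[of j] hom(2)[of k] aD])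
          \<comment> \<open>Proportional rows: together with \<open>relf\<close> they give
            \<open>?a dvd x i * (?c t * f p - ?c s * f q)\<close>. As the \<open>?a\<close>-values
            are not principal, \<open>?a\<close> divides all four entries, contrary to
            \<open>not_all\<close>.\<close>
          fix s t assume st: "s \<noteq> 0 \<or> t \<noteq> 0"
            "?a dvd ?c s * x j + ?c t * y j" "?a dvd ?c s * x k + ?c t * y k"
          have ax: "?a dvd x i" if i: "?a dvd ?c s * x i + ?c t * y i" for i
          proof (cases "t = 0")
            case True
            then show ?thesis using i st(1) linear_form_dvd_const_multD[of s a "x i"] by simp
          next
            case False
            have "x i * (?c t * f p - ?c s * f q) = ?c t * (x i * f p + y i * f q) - (?c s * x i + ?c t * y i) * f q"
              by (simp add: algebra_simps)
            moreover have "?a dvd \<dots>" using relf[of i] i by (intro dvd_diff dvd_mult dvd_mult2)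
            ultimately have "?a dvd x i * (?c t * f p - ?c s * f q)" by simp
            moreover have "\<not> ?a dvd ?c t * f p - ?c s * f q"
            proof
              assume "?a dvd ?c t * f p - ?c s * f q"
              moreover have "?c t * f p - ?c s * f q = ?c t * (f p - ?c (s / t) * f q)"
                using False by (simp add: right_diff_distrib mult_single flip: mult.assoc)
              ultimately have "?a dvd f p - ?c (s / t) * f q" using linear_form_dvd_const_multD[OF False] by simp
              then show False using f_ne(2) by blast
            qed
            ultimately show ?thesis using linear_form_prime[OF a] by blast
          qed
          have ay: "?a dvd y i" if "?a dvd x i" for i
          proof -
            have "?a dvd y i * f q" using relf[of i] that by (simp add: dvd_add_right_iff)
            then show ?thesis using linear_form_prime[OF a] nz by blast
          qed
          show False using not_all ax[OF st(2)] ax[OF st(3)] ay by blast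
        next
          \<comment> \<open>Proportional columns: the combined column is a constant vector
            \<open>(k1, k2)\<close> times \<open>?a\<close>, nonzero because the minor is. Inserting
            it into \<open>relg\<close> and cancelling \<open>?a\<close> modulo \<open>?b\<close>
            relates \<open>g p\<close> and \<open>g q\<close> by constants, so the
            \<open>?b\<close>-values would be principal.\<close>
          fix s t assume st: "s \<noteq> 0 \<or> t \<noteq> 0"
            "?a dvd ?c s * x j + ?c t * x k" "?a dvd ?c s * y j + ?c t * y k"
          have hc: "homogeneous 1 (?c s * u + ?c t * v)" if "homogeneous 1 u" "homogeneous 1 v" for u v
            using that hcomp_mult_homogeneous[OF that(1), of 1 "?c s"] hcomp_mult_homogeneous[OF that(2), of 1 "?c t"]
            by (simp add: homogeneous_def hcomp_add hcomp_const)
          obtain k1 where k1: "?c s * x j + ?c t * x k = ?c k1 * ?a"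
            using homogeneous_1_multiple[OF homogeneous_linear_form hc[OF hom(1) hom(1)] st(2)] .
          obtain k2 where k2: "?c s * y j + ?c t * y k = ?c k2 * ?a"
            using homogeneous_1_multiple[OF homogeneous_linear_form hc[OF hom(2) hom(2)] st(3)] .
          have "?c k1 \<noteq> 0 \<or> ?c k2 \<noteq> 0"
          proof (rule ccontr)
            assume "\<not> ?thesis"
            then have zero: "?c s * x j + ?c t * x k = 0" "?c s * y j + ?c t * y k = 0" using k1 k2 by simp_all
            have "?c s * ?D = (?c s * x j + ?c t * x k) * y k - x k * (?c s * y j + ?c t * y k)"
              "?c t * ?D = x j * (?c s * y j + ?c t * y k) - (?c s * x j + ?c t * x k) * y j"
              by (simp_all add: algebra_simps)
            then have "?c s * ?D = 0" "?c t * ?D = 0" unfolding zero by simp_all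
            then have "?c s = 0" "?c t = 0" using D mpoly_mult_eq_0 by blast+
            then show False using st(1) by (metis lookup_single_eq lookup_zero)
          qed
          then have k12: "k1 \<noteq> 0 \<or> k2 \<noteq> 0" by auto
          have "?a * (?c k1 * g p + ?c k2 * g q) = (?c k1 * ?a) * g p + (?c k2 * ?a) * g q" by (simp add: algebra_simps)
          also have "\<dots> = ?c s * (x j * g p + y j * g q) + ?c t * (x k * g p + y k * g q)"
            unfolding k1[symmetric] k2[symmetric] by (simp add: algebra_simps)
          finally have "?b dvd ?a * (?c k1 * g p + ?c k2 * g q)" using relg[of j] relg[of k] by simp
          then have bdvd: "?b dvd ?c k1 * g p + ?c k2 * g q" using linear_form_prime[OF b] ba by blast
          show False
          proof (cases "k1 = 0")
            case True
            then have "?b dvd g q" using bdvd k12 linear_form_dvd_const_multD[of k2 b "g q"] by simp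
            then show False using nz by blast
          next
            case False
            have "?c k1 * g p + ?c k2 * g q = ?c k1 * (g p - ?c (- k2 / k1) * g q)"
              using False by (simp add: distrib_left mult_single single_uminus flip: mult.assoc)
            then have "?b dvd g p - ?c (- k2 / k1) * g q" using bdvd linear_form_dvd_const_multD[OF False] by simp
            then show False using g_ne(2) by blast
          qed
        qed
      qed
    qed
    obtain p q where pq: "P = {p, q}" "p \<noteq> q" using True by (auto simp: card_2_iff)
    show thesis
    proof (cases "d p \<le> d q")
      case True
      then show thesis using two[OF pq] by blast
    next
      case False
      then show thesis using two[of q p] pq by (simp add: insert_commute)
    qed
  qed
qed

theorem theorem1p2:
  fixes A :: "('k::field ^ 'n::finite) set set"
    and H1 H2 :: "('k ^ 'n) set"
  assumes "arrangement A" and "essential A"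
    and "H1 \<in> A" and "H2 \<in> A"
    and "free_arrangement A"
    and "free_arrangement (A - {H1, H2})"
  shows "free_arrangement (A - {H1}) \<or> free_arrangement (A - {H2})"
proof (cases "H1 = H2")
  case True
  then show ?thesis using assms(6) by simp
next
  case False
  let ?B = "A - {H1, H2}"
  have B: "arrangement ?B" using assms(1) by (auto simp: arrangement_def)
  obtain a where a: "a \<noteq> 0" "form_kernel a = H1" "defining_form H1 = linear_form a"
    using defining_form_obtain[of H1] assms(1,3) unfolding arrangement_def by blast
  obtain b where b: "b \<noteq> 0" "form_kernel b = H2" "defining_form H2 = linear_form b"
    using defining_form_obtain[of H2] assms(1,4) unfolding arrangement_def by blast
  have ab: "\<not> linear_form a dvd linear_form b" "\<not> linear_form b dvd linear_form a"
    using linear_form_dvd_linear_form a b False by metis+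
  have A2: "A - {H2} = insert H1 ?B" and A1: "A - {H1} = insert H2 ?B" and A: "A = insert H1 (insert H2 ?B)"
    using False assms(3,4) by auto
  \<comment> \<open>The indices cross over: deleting \<open>H2\<close> leaves the condition from
    \<open>H1\<close>, so a principal image for \<open>a\<close> yields freeness of
    \<open>A - {H2}\<close>.\<close>
  have L2: "log_der (A - {H2}) = {m \<in> log_der ?B. linear_form a dvd der_apply m (linear_form a)}"
    unfolding A2 log_der_insert a(3) ..
  have L1: "log_der (A - {H1}) = {m \<in> log_der ?B. linear_form b dvd der_apply m (linear_form b)}"
    unfolding A1 log_der_insert b(3) ..
  have LA: "log_der A = {m \<in> log_der ?B. linear_form a dvd der_apply m (linear_form a) \<and>
      linear_form b dvd der_apply m (linear_form b)}"
    by (subst A) (auto simp: log_der_insert a(3) b(3))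
  obtain \<theta>0 where \<theta>0: "module_basis \<theta>0 (log_der ?B)" using free_log_der_basis[OF B assms(6)] .
  obtain \<psi> where \<psi>: "module_basis \<psi> (log_der A)" using free_log_der_basis[OF assms(1,5)] .
  obtain \<theta> r p where \<theta>: "module_basis \<theta> (log_der ?B)" and principal:
    "(\<forall>j. linear_form a dvd der_apply (\<theta> j) (linear_form a) - r j * der_apply (\<theta> p) (linear_form a)) \<or>
     (\<forall>j. linear_form b dvd der_apply (\<theta> j) (linear_form b) - r j * der_apply (\<theta> p) (linear_form b))"
    by (rule principal_image_exists[OF a(1) b(1) ab log_der_graded[OF B] \<theta>0 LA \<psi>])
  from principal show ?thesis
  proof
    assume "\<forall>j. linear_form a dvd der_apply (\<theta> j) (linear_form a) - r j * der_apply (\<theta> p) (linear_form a)"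
    then have "free_submodule (log_der (A - {H2}))" unfolding L2
      by (intro principal_image_imp_free[OF a(1) \<theta> log_der_submodule, of _ r p])
         (simp_all add: der_apply_add der_apply_scale)
    then show ?thesis by (simp add: free_arrangement_def)
  next
    assume "\<forall>j. linear_form b dvd der_apply (\<theta> j) (linear_form b) - r j * der_apply (\<theta> p) (linear_form b)"
    then have "free_submodule (log_der (A - {H1}))" unfolding L1
      by (intro principal_image_imp_free[OF b(1) \<theta> log_der_submodule, of _ r p])
         (simp_all add: der_apply_add der_apply_scale)
    then show ?thesis by (simp add: free_arrangement_def)
  qed
qed

end
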